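(* Let $X$, $X_1$, $X_2$ be three Frobenius algebras in a $\mathbbm{k}$-linear monoidal category $\mathcal{C}$ with $\mathbf{1}$ linear-simple. Assume that $X$ is connected. For $i=1,2$, let $f_i\in\mathrm{Hom}_{\mathcal{C}}(X_i,X)$ be an algebra morphism such that $f_i^{**}=f_i$, and let $g_i:=f_i\circ f_i^*$. Then $$\mu_X\,(g_1*g_2)\circ(g_1*g_2)=\mathrm{tr}(g_1\circ g_2)\,(g_1*g_2).$$ Moreover, for every algebra morphism $\alpha\in\mathrm{End}_{\mathcal{C}}(X)$ (for instance $\alpha=\mathrm{id}_X$), $$\mu_X\,\mathrm{tr}_\alpha(g_1*g_2)=\mathrm{tr}_\alpha(g_1)\,\mathrm{tr}_\alpha(g_2),$$ where $\mathrm{tr}_\alpha(h):=\mathrm{tr}(\alpha\circ h)$. As a result, if $\mathrm{tr}(g_1\circ g_2)$ is nonzero, then $$g_{12}:=\frac{\mu_X}{\mathrm{tr}(g_1\circ g_2)}\,g_1*g_2$$ is an idempotent, and $$\mathrm{tr}_\alpha(g_{12})=\frac{\mathrm{tr}_\alpha(g_1)\,\mathrm{tr}_\alpha(g_2)}{\mathrm{tr}(g_1\circ g_2)}$$ (the trace in the denominator is not indexed by $\alpha$). Finally (still when $\mathrm{tr}(g_1\circ g_2)\neq0$), $g_{12}\circ g_i=g_i=g_i\circ g_{12}$ for $i\in\{1,2\}$.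
   Context: $\mathbbm{k}$ is a field. Monoidal categories are taken strict. Linear-simple unit: $\mathrm{Hom}_{\mathcal C}(\mathbf 1,\mathbf 1)=\mathbbm{k}$ (so its elements are treated as scalars). A left dual of $X$ is $(X^*,\mathrm{ev}_X:X^*\otimes X\to\mathbf 1,\mathrm{coev}_X:\mathbf 1\to X\otimes X^* )$ satisfying the zigzag identities; $f^*:Y^*\to X^*$ is the dual of $f:X\to Y$. A Frobenius algebra is $(X,m,\delta,e,\epsilon)$ with $(X,m,e)$ a unital algebra, $(X,\delta,\epsilon)$ a counital coalgebra and $(\mathrm{id}_X\otimes m)\circ(\delta\otimes \mathrm{id}_X)=\delta\circ m=(m\otimes \mathrm{id}_X)\circ(\mathrm{id}_X\otimes\delta)$. It is always regarded as selfdual, $X^*=X$ (hence $X^{**}=X$), with $\mathrm{ev}_X=\epsilon\circ m$ and $\mathrm{coev}_X=\delta\circ e$. $X$ is connected if $\mathrm{Hom}_{\mathcal C}(\mathbf 1,X)$ is one-dimensional. An algebra morphism $f:X'\to X$ is a morphism with $m\circ(f\otimes f)=f\circ m'$. $\mu_X\in\mathbbm{k}$ is the scalar $\epsilon\circ e$. For $\alpha:X\to X^{**}$, $\mathrm{tr}(\alpha):=\mathrm{ev}_{X^*}\circ(\alpha\otimes\mathrm{id}_{X^*})\circ\mathrm{coev}_X\in\mathrm{End}(\mathbf 1)=\mathbbm{k}$; for $X$ a Frobenius algebra this applies to every $\alpha\in\mathrm{End}_{\mathcal C}(X)$. Convolution product of $a,b\in\mathrm{End}_{\mathcal C}(X)$: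 $a*b:=m\circ(a\otimes b)\circ\delta\in\mathrm{End}_{\mathcal C}(X)$. *)

theory Defs
  imports "Jordan_Normal_Form.Missing_VectorSpace"
begin

section \<open>Linear strict monoidal categories\<close>

text \<open>
  Each \<open>Hom\<close> is a module record, of which the ring multiplication and the one are never used.
  The operations are unspecified outside objects and morphisms of matching source and target.
\<close>

record ('o, 'm, 'k) lin_mon_cat =
  Obj :: "'o set"
  Hom :: "'o \<Rightarrow> 'o \<Rightarrow> ('k, 'm) module"
  mcomp :: "'m \<Rightarrow> 'm \<Rightarrow> 'm"  (infixl "\<cdot>\<index>" 65)
  ident :: "'o \<Rightarrow> 'm"
  unit_obj :: "'o"
  tens_obj :: "'o \<Rightarrow> 'o \<Rightarrow> 'o"  (infixl "\<boxtimes>\<^sub>o\<index>" 75)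
  tens :: "'m \<Rightarrow> 'm \<Rightarrow> 'm"  (infixl "\<boxtimes>\<index>" 75)

abbreviation hom_set :: "('o, 'm, 'k) lin_mon_cat \<Rightarrow> 'o \<Rightarrow> 'o \<Rightarrow> 'm set"
  where "hom_set C A B \<equiv> carrier (Hom C A B)"

locale strict_linear_monoidal_category =
  fixes K :: "('k, 'r) ring_scheme"
    and C :: "('o, 'm, 'k) lin_mon_cat" (structure)
  assumes field_K: "field K"
    and hom_vectorspace: "\<lbrakk>A \<in> Obj C; B \<in> Obj C\<rbrakk> \<Longrightarrow> vectorspace K (Hom C A B)"
    and hom_disjoint:
      "\<lbrakk>A \<in> Obj C; B \<in> Obj C; A' \<in> Obj C; B' \<in> Obj C; f \<in> hom_set C A B; f \<in> hom_set C A' B'\<rbrakk>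
        \<Longrightarrow> A = A' \<and> B = B'"
    and ident_closed: "A \<in> Obj C \<Longrightarrow> ident C A \<in> hom_set C A A"
    and comp_closed:
      "\<lbrakk>A \<in> Obj C; B \<in> Obj C; D \<in> Obj C; g \<in> hom_set C B D; f \<in> hom_set C A B\<rbrakk>
        \<Longrightarrow> g \<cdot> f \<in> hom_set C A D"
    and comp_assoc:
      "\<lbrakk>A \<in> Obj C; B \<in> Obj C; D \<in> Obj C; E \<in> Obj C;
        h \<in> hom_set C D E; g \<in> hom_set C B D; f \<in> hom_set C A B\<rbrakk>
        \<Longrightarrow> (h \<cdot> g) \<cdot> f = h \<cdot> (g \<cdot> f)"
    and comp_ident_left:
      "\<lbrakk>A \<in> Obj C; B \<in> Obj C; f \<in> hom_set C A B\<rbrakk> \<Longrightarrow> ident C B \<cdot> f = f"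
    and comp_ident_right:
      "\<lbrakk>A \<in> Obj C; B \<in> Obj C; f \<in> hom_set C A B\<rbrakk> \<Longrightarrow> f \<cdot> ident C A = f"
    and comp_linear_right:
      "\<lbrakk>A \<in> Obj C; B \<in> Obj C; D \<in> Obj C; g \<in> hom_set C B D\<rbrakk>
        \<Longrightarrow> (\<lambda>f. g \<cdot> f) \<in> module_hom K (Hom C A B) (Hom C A D)"
    and comp_linear_left:
      "\<lbrakk>A \<in> Obj C; B \<in> Obj C; D \<in> Obj C; f \<in> hom_set C A B\<rbrakk>
        \<Longrightarrow> (\<lambda>g. g \<cdot> f) \<in> module_hom K (Hom C B D) (Hom C A D)"
    and unit_obj_closed: "unit_obj C \<in> Obj C"
    and tens_obj_closed: "\<lbrakk>A \<in> Obj C; B \<in> Obj C\<rbrakk> \<Longrightarrow> A \<boxtimes>\<^sub>o B \<in> Obj C"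
    and tens_obj_assoc:
      "\<lbrakk>A \<in> Obj C; B \<in> Obj C; D \<in> Obj C\<rbrakk>
        \<Longrightarrow> (A \<boxtimes>\<^sub>o B) \<boxtimes>\<^sub>o D = A \<boxtimes>\<^sub>o (B \<boxtimes>\<^sub>o D)"
    and tens_obj_unit_left: "A \<in> Obj C \<Longrightarrow> unit_obj C \<boxtimes>\<^sub>o A = A"
    and tens_obj_unit_right: "A \<in> Obj C \<Longrightarrow> A \<boxtimes>\<^sub>o unit_obj C = A"
    and tens_closed:
      "\<lbrakk>A \<in> Obj C; B \<in> Obj C; A' \<in> Obj C; B' \<in> Obj C; f \<in> hom_set C A B; g \<in> hom_set C A' B'\<rbrakk>
        \<Longrightarrow> f \<boxtimes> g \<in> hom_set C (A \<boxtimes>\<^sub>o A') (B \<boxtimes>\<^sub>o B')"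
    and tens_ident:
      "\<lbrakk>A \<in> Obj C; B \<in> Obj C\<rbrakk> \<Longrightarrow> ident C A \<boxtimes> ident C B = ident C (A \<boxtimes>\<^sub>o B)"
    and interchange:
      "\<lbrakk>A \<in> Obj C; B \<in> Obj C; D \<in> Obj C; A' \<in> Obj C; B' \<in> Obj C; D' \<in> Obj C;
        f \<in> hom_set C A B; g \<in> hom_set C B D; f' \<in> hom_set C A' B'; g' \<in> hom_set C B' D'\<rbrakk>
        \<Longrightarrow> (g \<cdot> f) \<boxtimes> (g' \<cdot> f') = (g \<boxtimes> g') \<cdot> (f \<boxtimes> f')"
    and tens_assoc:
      "\<lbrakk>A \<in> Obj C; B \<in> Obj C; A' \<in> Obj C; B' \<in> Obj C; A'' \<in> Obj C; B'' \<in> Obj C;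
        f \<in> hom_set C A B; g \<in> hom_set C A' B'; h \<in> hom_set C A'' B''\<rbrakk>
        \<Longrightarrow> (f \<boxtimes> g) \<boxtimes> h = f \<boxtimes> (g \<boxtimes> h)"
    and tens_unit_left:
      "\<lbrakk>A \<in> Obj C; B \<in> Obj C; f \<in> hom_set C A B\<rbrakk> \<Longrightarrow> ident C (unit_obj C) \<boxtimes> f = f"
    and tens_unit_right:
      "\<lbrakk>A \<in> Obj C; B \<in> Obj C; f \<in> hom_set C A B\<rbrakk> \<Longrightarrow> f \<boxtimes> ident C (unit_obj C) = f"
    and tens_linear_right:
      "\<lbrakk>A \<in> Obj C; B \<in> Obj C; A' \<in> Obj C; B' \<in> Obj C; f \<in> hom_set C A B\<rbrakk>
        \<Longrightarrow> (\<lambda>g. f \<boxtimes> g) \<in> module_hom K (Hom C A' B') (Hom C (A \<boxtimes>\<^sub>o A') (B \<boxtimes>\<^sub>o B'))"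
    and tens_linear_left:
      "\<lbrakk>A \<in> Obj C; B \<in> Obj C; A' \<in> Obj C; B' \<in> Obj C; g \<in> hom_set C A' B'\<rbrakk>
        \<Longrightarrow> (\<lambda>f. f \<boxtimes> g) \<in> module_hom K (Hom C A B) (Hom C (A \<boxtimes>\<^sub>o A') (B \<boxtimes>\<^sub>o B'))"

text \<open>
  The equality of the endomorphisms of the unit object with the ground field is the canonical one,
  sending a scalar \<open>c\<close> to \<open>c\<close> times the identity.
\<close>

definition scalar_mor ::
    "('o, 'm, 'k) lin_mon_cat \<Rightarrow> 'k \<Rightarrow> 'm"
  where "scalar_mor C c = c \<odot>\<^bsub>Hom C (unit_obj C) (unit_obj C)\<^esub> ident C (unit_obj C)"

definition linear_simple_unit ::
    "('k, 'r) ring_scheme \<Rightarrow> ('o, 'm, 'k) lin_mon_cat \<Rightarrow> bool"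
  where "linear_simple_unit K C \<longleftrightarrow>
    bij_betw (scalar_mor C) (carrier K) (hom_set C (unit_obj C) (unit_obj C))"

definition scalar_of ::
    "('k, 'r) ring_scheme \<Rightarrow> ('o, 'm, 'k) lin_mon_cat \<Rightarrow> 'm \<Rightarrow> 'k"
  where "scalar_of K C = the_inv_into (carrier K) (scalar_mor C)"

section \<open>Left duals and traces\<close>

record ('o, 'm) left_dual =
  base :: "'o"
  dual :: "'o"
  ev :: "'m"
  coev :: "'m"

definition is_left_dual :: "('o, 'm, 'k) lin_mon_cat \<Rightarrow> ('o, 'm) left_dual \<Rightarrow> bool"
  where "is_left_dual C D \<longleftrightarrow>
    base D \<in> Obj C \<and> dual D \<in> Obj C \<and>
    ev D \<in> hom_set C (dual D \<boxtimes>\<^sub>o\<^bsub>C\<^esub> base D) (unit_obj C) \<and>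
    coev D \<in> hom_set C (unit_obj C) (base D \<boxtimes>\<^sub>o\<^bsub>C\<^esub> dual D) \<and>
    (ident C (base D) \<boxtimes>\<^bsub>C\<^esub> ev D) \<cdot>\<^bsub>C\<^esub> (coev D \<boxtimes>\<^bsub>C\<^esub> ident C (base D)) = ident C (base D) \<and>
    (ev D \<boxtimes>\<^bsub>C\<^esub> ident C (dual D)) \<cdot>\<^bsub>C\<^esub> (ident C (dual D) \<boxtimes>\<^bsub>C\<^esub> coev D) = ident C (dual D)"

text \<open>
  The dual of \<open>f : X \<rightarrow> Y\<close> with respect to chosen left duals \<open>DX\<close> of \<open>X\<close> and \<open>DY\<close> of \<open>Y\<close>, as
  the composite of \<open>Y* \<rightarrow> Y* X X*\<close>, \<open>Y* X X* \<rightarrow> Y* Y X*\<close> and \<open>Y* Y X* \<rightarrow> X*\<close>.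
\<close>

definition dual_mor ::
    "('o, 'm, 'k) lin_mon_cat \<Rightarrow> ('o, 'm) left_dual \<Rightarrow> ('o, 'm) left_dual \<Rightarrow> 'm \<Rightarrow> 'm"
  where "dual_mor C DX DY f =
    (ev DY \<boxtimes>\<^bsub>C\<^esub> ident C (dual DX))
      \<cdot>\<^bsub>C\<^esub> (ident C (dual DY) \<boxtimes>\<^bsub>C\<^esub> f \<boxtimes>\<^bsub>C\<^esub> ident C (dual DX))
      \<cdot>\<^bsub>C\<^esub> (ident C (dual DY) \<boxtimes>\<^bsub>C\<^esub> coev DX)"

text \<open>
  The trace of \<open>\<alpha> : X \<rightarrow> X**\<close>, where \<open>D\<close> is a left dual of \<open>X\<close> and \<open>DD\<close> is a left dual of \<open>X*\<close>.
\<close>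

definition trace ::
    "('k, 'r) ring_scheme \<Rightarrow> ('o, 'm, 'k) lin_mon_cat \<Rightarrow>
     ('o, 'm) left_dual \<Rightarrow> ('o, 'm) left_dual \<Rightarrow> 'm \<Rightarrow> 'k"
  where "trace K C D DD \<alpha> =
    scalar_of K C (ev DD \<cdot>\<^bsub>C\<^esub> (\<alpha> \<boxtimes>\<^bsub>C\<^esub> ident C (dual D)) \<cdot>\<^bsub>C\<^esub> coev D)"

section \<open>Frobenius algebras\<close>

record ('o, 'm) frob_alg =
  ob :: "'o"
  mul :: "'m"
  comul :: "'m"
  unit :: "'m"
  counit :: "'m"

definition unital_algebra ::
    "('o, 'm, 'k) lin_mon_cat \<Rightarrow> 'o \<Rightarrow> 'm \<Rightarrow> 'm \<Rightarrow> bool"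
  where "unital_algebra C A m e \<longleftrightarrow>
    A \<in> Obj C \<and> m \<in> hom_set C (A \<boxtimes>\<^sub>o\<^bsub>C\<^esub> A) A \<and> e \<in> hom_set C (unit_obj C) A \<and>
    m \<cdot>\<^bsub>C\<^esub> (m \<boxtimes>\<^bsub>C\<^esub> ident C A) = m \<cdot>\<^bsub>C\<^esub> (ident C A \<boxtimes>\<^bsub>C\<^esub> m) \<and>
    m \<cdot>\<^bsub>C\<^esub> (e \<boxtimes>\<^bsub>C\<^esub> ident C A) = ident C A \<and>
    m \<cdot>\<^bsub>C\<^esub> (ident C A \<boxtimes>\<^bsub>C\<^esub> e) = ident C A"

definition counital_coalgebra ::
    "('o, 'm, 'k) lin_mon_cat \<Rightarrow> 'o \<Rightarrow> 'm \<Rightarrow> 'm \<Rightarrow> bool"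
  where "counital_coalgebra C A \<delta> \<epsilon> \<longleftrightarrow>
    A \<in> Obj C \<and> \<delta> \<in> hom_set C A (A \<boxtimes>\<^sub>o\<^bsub>C\<^esub> A) \<and> \<epsilon> \<in> hom_set C A (unit_obj C) \<and>
    (\<delta> \<boxtimes>\<^bsub>C\<^esub> ident C A) \<cdot>\<^bsub>C\<^esub> \<delta> = (ident C A \<boxtimes>\<^bsub>C\<^esub> \<delta>) \<cdot>\<^bsub>C\<^esub> \<delta> \<and>
    (\<epsilon> \<boxtimes>\<^bsub>C\<^esub> ident C A) \<cdot>\<^bsub>C\<^esub> \<delta> = ident C A \<and>
    (ident C A \<boxtimes>\<^bsub>C\<^esub> \<epsilon>) \<cdot>\<^bsub>C\<^esub> \<delta> = ident C A"

definition frobenius_algebra ::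
    "('o, 'm, 'k) lin_mon_cat \<Rightarrow> ('o, 'm) frob_alg \<Rightarrow> bool"
  where "frobenius_algebra C X \<longleftrightarrow>
    unital_algebra C (ob X) (mul X) (unit X) \<and>
    counital_coalgebra C (ob X) (comul X) (counit X) \<and>
    (ident C (ob X) \<boxtimes>\<^bsub>C\<^esub> mul X) \<cdot>\<^bsub>C\<^esub> (comul X \<boxtimes>\<^bsub>C\<^esub> ident C (ob X)) = comul X \<cdot>\<^bsub>C\<^esub> mul X \<and>
    (mul X \<boxtimes>\<^bsub>C\<^esub> ident C (ob X)) \<cdot>\<^bsub>C\<^esub> (ident C (ob X) \<boxtimes>\<^bsub>C\<^esub> comul X) = comul X \<cdot>\<^bsub>C\<^esub> mul X"

text \<open>Algebra morphisms are not required to preserve the units.\<close>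

definition algebra_morphism ::
    "('o, 'm, 'k) lin_mon_cat \<Rightarrow> ('o, 'm) frob_alg \<Rightarrow> ('o, 'm) frob_alg \<Rightarrow> 'm \<Rightarrow> bool"
  where "algebra_morphism C X' X f \<longleftrightarrow>
    f \<in> hom_set C (ob X') (ob X) \<and> mul X \<cdot>\<^bsub>C\<^esub> (f \<boxtimes>\<^bsub>C\<^esub> f) = f \<cdot>\<^bsub>C\<^esub> mul X'"

definition connected_algebra ::
    "('k, 'r) ring_scheme \<Rightarrow> ('o, 'm, 'k) lin_mon_cat \<Rightarrow> ('o, 'm) frob_alg \<Rightarrow> bool"
  where "connected_algebra K C X \<longleftrightarrow>
    vectorspace.fin_dim K (Hom C (unit_obj C) (ob X)) \<and>
    vectorspace.dim K (Hom C (unit_obj C) (ob X)) = 1"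

definition frob_dual ::
    "('o, 'm, 'k) lin_mon_cat \<Rightarrow> ('o, 'm) frob_alg \<Rightarrow> ('o, 'm) left_dual"
  where "frob_dual C X =
    \<lparr>base = ob X, dual = ob X, ev = counit X \<cdot>\<^bsub>C\<^esub> mul X, coev = comul X \<cdot>\<^bsub>C\<^esub> unit X\<rparr>"

text \<open>
  For a morphism \<open>f : X \<rightarrow> Y\<close> between Frobenius algebras, \<open>frob_star C X Y f : Y \<rightarrow> X\<close> is its dual
  with respect to the selfdual structures.
\<close>

definition frob_star ::
    "('o, 'm, 'k) lin_mon_cat \<Rightarrow> ('o, 'm) frob_alg \<Rightarrow> ('o, 'm) frob_alg \<Rightarrow> 'm \<Rightarrow> 'm"
  where "frob_star C X Y f = dual_mor C (frob_dual C X) (frob_dual C Y) f"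

definition frob_tr ::
    "('k, 'r) ring_scheme \<Rightarrow> ('o, 'm, 'k) lin_mon_cat \<Rightarrow> ('o, 'm) frob_alg \<Rightarrow> 'm \<Rightarrow> 'k"
  where "frob_tr K C X \<alpha> = trace K C (frob_dual C X) (frob_dual C X) \<alpha>"

definition frob_mu ::
    "('k, 'r) ring_scheme \<Rightarrow> ('o, 'm, 'k) lin_mon_cat \<Rightarrow> ('o, 'm) frob_alg \<Rightarrow> 'k"
  where "frob_mu K C X = scalar_of K C (counit X \<cdot>\<^bsub>C\<^esub> unit X)"

definition convol ::
    "('o, 'm, 'k) lin_mon_cat \<Rightarrow> ('o, 'm) frob_alg \<Rightarrow> 'm \<Rightarrow> 'm \<Rightarrow> 'm"
  where "convol C X a b = mul X \<cdot>\<^bsub>C\<^esub> (a \<boxtimes>\<^bsub>C\<^esub> b) \<cdot>\<^bsub>C\<^esub> comul X"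

text \<open>The selfdual structure of a Frobenius algebra is a left dual.\<close>

lemma (in strict_linear_monoidal_category) frob_dual_is_left_dual:
  assumes "frobenius_algebra C X"
  shows "is_left_dual C (frob_dual C X)"
proof -
  define A where "A = ob X"
  define I where "I = unit_obj C"
  define i where "i = ident C A"
  define m where "m = mul X"
  define d where "d = comul X"
  define e where "e = unit X"
  define n where "n = counit X"
  note defs = A_def I_def i_def m_def d_def e_def n_def
  have A: "A \<in> Obj C" and m: "m \<in> hom_set C (A \<boxtimes>\<^sub>o A) A" and e: "e \<in> hom_set C I A"
    and d: "d \<in> hom_set C A (A \<boxtimes>\<^sub>o A)" and n: "n \<in> hom_set C A I"
    and e1: "m \<cdot> (e \<boxtimes> i) = i" and e2: "m \<cdot> (i \<boxtimes> e) = i"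
    and n1: "(n \<boxtimes> i) \<cdot> d = i" and n2: "(i \<boxtimes> n) \<cdot> d = i"
    and F1: "(i \<boxtimes> m) \<cdot> (d \<boxtimes> i) = d \<cdot> m"
    and F2: "(m \<boxtimes> i) \<cdot> (i \<boxtimes> d) = d \<cdot> m"
    using assms
    unfolding frobenius_algebra_def unital_algebra_def counital_coalgebra_def defs by auto
  have I: "I \<in> Obj C" by (simp add: I_def unit_obj_closed)
  have i: "i \<in> hom_set C A A" using A by (simp add: i_def ident_closed)
  have ii: "i \<cdot> i = i" using A i by (simp add: i_def comp_ident_left)
  define B where "B = A \<boxtimes>\<^sub>o A"
  define D where "D = A \<boxtimes>\<^sub>o B"
  have B: "B \<in> Obj C" and D: "D \<in> Obj C" and BA: "B \<boxtimes>\<^sub>o A = D" and AB: "A \<boxtimes>\<^sub>o B = D"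
    and IA: "I \<boxtimes>\<^sub>o A = A" and AI: "A \<boxtimes>\<^sub>o I = A" and AA: "A \<boxtimes>\<^sub>o A = B"
    using A by (auto simp: B_def D_def I_def tens_obj_closed tens_obj_assoc
        tens_obj_unit_left tens_obj_unit_right)
  note m' = m[folded B_def] and d' = d[folded B_def]
  have whisker_right: "(g \<cdot> f) \<boxtimes> i = (g \<boxtimes> i) \<cdot> (f \<boxtimes> i)"
    if "P \<in> Obj C" "Q \<in> Obj C" "R \<in> Obj C" "f \<in> hom_set C P Q" "g \<in> hom_set C Q R" for P Q R f g
    using interchange[OF that(1-3) A A A that(4,5) i i] by (simp add: ii)
  have whisker_left: "i \<boxtimes> (g \<cdot> f) = (i \<boxtimes> g) \<cdot> (i \<boxtimes> f)"
    if "P \<in> Obj C" "Q \<in> Obj C" "R \<in> Obj C" "f \<in> hom_set C P Q" "g \<in> hom_set C Q R" for P Q R f g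
    using interchange[OF A A A that(1-3) i i that(4,5)] by (simp add: ii)
  have zigzag: "(q \<cdot> p) \<cdot> (s \<cdot> r) = i"
    if r: "r \<in> hom_set C A B" and s: "s \<in> hom_set C B D" and p: "p \<in> hom_set C D B"
      and q: "q \<in> hom_set C B A" and ps: "p \<cdot> s = d \<cdot> m" and mr: "m \<cdot> r = i" and qd: "q \<cdot> d = i"
    for p q r s
  proof -
    have sr: "s \<cdot> r \<in> hom_set C A D" by (rule comp_closed[OF A B D s r])
    have "(q \<cdot> p) \<cdot> (s \<cdot> r) = q \<cdot> (p \<cdot> (s \<cdot> r))"
      by (rule comp_assoc[OF A D B A q p sr])
    also have "p \<cdot> (s \<cdot> r) = (d \<cdot> m) \<cdot> r"
      using comp_assoc[OF A B D B p s r] by (simp add: ps)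
    also have "\<dots> = d \<cdot> (m \<cdot> r)" by (rule comp_assoc[OF A B A B d' m' r])
    also have "\<dots> = d" using comp_ident_right[OF A B d'] by (simp add: mr i_def)
    finally show ?thesis by (simp add: qd)
  qed
  have z1: "(i \<boxtimes> (n \<cdot> m)) \<cdot> ((d \<cdot> e) \<boxtimes> i) = i"
    unfolding whisker_left[OF B A I m' n] whisker_right[OF I A B e d']
    using tens_closed[OF A A A I i n] tens_closed[OF A A B A i m']
      tens_closed[OF A B A A d' i] tens_closed[OF I A A A e i]
    by (intro zigzag) (simp_all add: AA AB BA IA AI F1 e1 n2)
  have z2: "((n \<cdot> m) \<boxtimes> i) \<cdot> (i \<boxtimes> (d \<cdot> e)) = i"
    unfolding whisker_right[OF B A I m' n] whisker_left[OF I A B e d']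
    using tens_closed[OF A I A A n i] tens_closed[OF B A A A m' i]
      tens_closed[OF A A A B i d'] tens_closed[OF A A I A i e]
    by (intro zigzag) (simp_all add: AA AB BA IA AI F2 e2 n1)
  have "n \<cdot> m \<in> hom_set C B I" by (rule comp_closed[OF B A I n m'])
  moreover have "d \<cdot> e \<in> hom_set C I B" by (rule comp_closed[OF I A B d' e])
  ultimately show ?thesis
    using A z1 z2 unfolding is_left_dual_def frob_dual_def B_def defs by simp
qed

end

theory Submission
  imports Defs
begin

text \<open>
  Write \<open>h\<^sub>i\<close> for the dual of \<open>f\<^sub>i\<close> and \<open>\<phi> = g\<^sub>1 * g\<^sub>2\<close>. The heart of the matter is that \<open>\<phi>\<close> is linear
  over the two given algebras: \<open>f\<^sub>1\<close> makes \<open>X\<close> a left \<open>X\<^sub>1\<close>-module, \<open>f\<^sub>2\<close> makes it a right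
  \<open>X\<^sub>2\<close>-module (not necessarily unital), and \<open>\<phi>\<close> commutes with both actions. In a string diagram for \<open>g\<^sub>1 * b\<close>, with \<open>b\<close> any
  endomorphism of \<open>X\<close>, the dual \<open>h\<^sub>1\<close> can be slid along the copairing of \<open>X\<close>, where it turns into
  \<open>f\<^sub>1\<close> on the copairing of \<open>X\<^sub>1\<close>; after that, only products in \<open>X\<^sub>1\<close> and their images are
  involved, and the Frobenius law of \<open>X\<^sub>1\<close> moves an element of \<open>X\<^sub>1\<close> from the right of \<open>\<phi>\<close> to its
  left (\<open>convol_left_module\<close>, and \<open>convol_right_module\<close> for the mirror image).

  A linear map in this sense is determined on the image of \<open>f\<^sub>i\<close> by its value on the unit of \<open>X\<close>,
  and connectedness of \<open>X\<close> makes that value proportional to the unit: \<open>\<mu> x = (\<epsilon> x) e\<close> for every \<open>x : 1 \<rightarrow> X\<close>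
  (\<open>connected_exchange\<close>). Hence \<open>\<mu> \<phi> f\<^sub>i = s f\<^sub>i\<close> with \<open>s = \<epsilon> \<phi> e\<close>, and the self-adjointness of
  \<open>g\<^sub>2\<close> identifies \<open>s\<close> with \<open>tr (g\<^sub>1 g\<^sub>2)\<close>. Everything else follows:

  \<^item> composing with \<open>h\<^sub>i\<close> gives \<open>\<mu> \<phi> g\<^sub>i = tr (g\<^sub>1 g\<^sub>2) g\<^sub>i\<close>;
  \<^item> duality reverses convolution (\<open>mate_convol\<close>), so the dual of the same statement for
    \<open>g\<^sub>2 * g\<^sub>1\<close> gives \<open>\<mu> g\<^sub>i \<phi> = tr (g\<^sub>1 g\<^sub>2) g\<^sub>i\<close>;
  \<^item> linearity over \<open>X\<^sub>1\<close> gives \<open>\<phi> \<phi> = g\<^sub>1 * (\<phi> g\<^sub>2)\<close>, whence the quadratic relation;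
  \<^item> \<open>a * id\<close> is right \<open>X\<close>-linear for every endomorphism \<open>a\<close>, so \<open>\<mu> (a * id) = tr (a) id\<close>; by
    associativity of convolution \<open>\<mu> tr (a * b) = tr (a) tr (b)\<close>. An algebra morphism \<open>\<alpha>\<close> satisfies
    \<open>\<alpha> (g\<^sub>1 * g\<^sub>2) = (\<alpha> g\<^sub>1) * (\<alpha> g\<^sub>2)\<close>, which yields the trace formula.
\<close>

section \<open>Diagrammatic calculus in a strict monoidal category\<close>

context strict_linear_monoidal_category
begin

text \<open>
  Since the hom sets are disjoint, a morphism determines its source and target. Turning them into
  functions removes the intermediate objects from the side conditions of the category laws, so that
  the simplifier can check by computation whether two morphisms are composable.
\<close>

definition mor :: "'m \<Rightarrow> bool"
  where "mor f \<longleftrightarrow> (\<exists>A\<in>Obj C. \<exists>B\<in>Obj C. f \<in> hom_set C A B)"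

definition source :: "'m \<Rightarrow> 'o"
  where "source f = (THE A. A \<in> Obj C \<and> (\<exists>B\<in>Obj C. f \<in> hom_set C A B))"

definition target :: "'m \<Rightarrow> 'o"
  where "target f = (THE B. B \<in> Obj C \<and> (\<exists>A\<in>Obj C. f \<in> hom_set C A B))"

lemma hom_setD:
  assumes "A \<in> Obj C" "B \<in> Obj C" "f \<in> hom_set C A B"
  shows "mor f" "source f = A" "target f = B"
  unfolding mor_def source_def target_def
  using assms hom_disjoint by (blast intro: the_equality)+

lemma morD [simp, intro]:
  assumes "mor f"
  shows "source f \<in> Obj C" "target f \<in> Obj C" "f \<in> hom_set C (source f) (target f)"
  using assms hom_setD unfolding mor_def by metis+

lemma hom_set_iff:
  assumes "A \<in> Obj C" "B \<in> Obj C"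
  shows "f \<in> hom_set C A B \<longleftrightarrow> mor f \<and> source f = A \<and> target f = B"
  using assms hom_setD morD by metis

declare unit_obj_closed [simp] tens_obj_closed [simp] tens_obj_assoc [simp]
  tens_obj_unit_left [simp] tens_obj_unit_right [simp] tens_ident [simp]

lemma mor_ident [simp]:
  assumes "A \<in> Obj C"
  shows "mor (ident C A)" "source (ident C A) = A" "target (ident C A) = A"
  using assms ident_closed hom_setD by blast+

lemma mor_comp [simp]:
  assumes "mor g" "mor f" "target f = source g"
  shows "mor (g \<cdot> f)" "source (g \<cdot> f) = source f" "target (g \<cdot> f) = target g"
proof -
  have "g \<cdot> f \<in> hom_set C (source f) (target g)"
    using comp_closed[of "source f" "source g" "target g" g f] assms morD by metis
  then show "mor (g \<cdot> f)" "source (g \<cdot> f) = source f" "target (g \<cdot> f) = target g"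
    using assms hom_setD morD by blast+
qed

lemma mor_tens [simp]:
  assumes "mor f" "mor g"
  shows "mor (f \<boxtimes> g)" "source (f \<boxtimes> g) = source f \<boxtimes>\<^sub>o source g"
    "target (f \<boxtimes> g) = target f \<boxtimes>\<^sub>o target g"
proof -
  have "f \<boxtimes> g \<in> hom_set C (source f \<boxtimes>\<^sub>o source g) (target f \<boxtimes>\<^sub>o target g)"
    using assms tens_closed by simp
  then show "mor (f \<boxtimes> g)" "source (f \<boxtimes> g) = source f \<boxtimes>\<^sub>o source g"
    "target (f \<boxtimes> g) = target f \<boxtimes>\<^sub>o target g"
    using assms by (simp_all add: hom_set_iff)
qed

lemma comp_assoc_mor [simp]:
  assumes "mor h" "mor g" "mor f" "target f = source g" "target g = source h"
  shows "(h \<cdot> g) \<cdot> f = h \<cdot> (g \<cdot> f)"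
  using assms comp_assoc[of "source f" "source g" "source h" "target h"] morD by metis

lemma comp_ident_mor [simp]:
  assumes "mor f"
  shows "target f = B \<Longrightarrow> ident C B \<cdot> f = f" "source f = A \<Longrightarrow> f \<cdot> ident C A = f"
  using assms comp_ident_left comp_ident_right by blast+

lemma tens_assoc_mor [simp]:
  assumes "mor f" "mor g" "mor h"
  shows "(f \<boxtimes> g) \<boxtimes> h = f \<boxtimes> (g \<boxtimes> h)"
  using assms tens_assoc by blast

lemma tens_unit_mor [simp]:
  assumes "mor f"
  shows "ident C (unit_obj C) \<boxtimes> f = f" "f \<boxtimes> ident C (unit_obj C) = f"
  using assms tens_unit_left tens_unit_right by blast+

text \<open>
  Together with the associativity law this gives tensor products a normal form: bracketed to the
  right, with adjacent identities fused. A calculation that needs the interchange law for another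
  bracketing switches these rules off.
\<close>

lemma tens_ident_assoc [simp]:
  assumes "A \<in> Obj C" "B \<in> Obj C" "mor f"
  shows "ident C A \<boxtimes> (ident C B \<boxtimes> f) = ident C (A \<boxtimes>\<^sub>o B) \<boxtimes> f"
  using assms tens_assoc_mor[of "ident C A" "ident C B" f] by simp

lemma interchange_mor:
  assumes "mor g" "mor f" "target f = source g" "mor g'" "mor f'" "target f' = source g'"
  shows "(g \<boxtimes> g') \<cdot> (f \<boxtimes> f') = (g \<cdot> f) \<boxtimes> (g' \<cdot> f')"
  using assms interchange[of "source f" "source g" "target g" "source f'" "source g'" "target g'"]
    morD by metis

lemma interchange_mor_assoc:
  assumes "mor g" "mor f" "target f = source g" "mor g'" "mor f'" "target f' = source g'"
    "mor k" "target k = source f \<boxtimes>\<^sub>o source f'"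
  shows "(g \<boxtimes> g') \<cdot> ((f \<boxtimes> f') \<cdot> k) = ((g \<cdot> f) \<boxtimes> (g' \<cdot> f')) \<cdot> k"
  using assms by (simp add: interchange_mor[symmetric])

end

section \<open>Frobenius algebras and their self-duality\<close>

definition pairing :: "('o, 'm, 'k) lin_mon_cat \<Rightarrow> ('o, 'm) frob_alg \<Rightarrow> 'm"
  where "pairing C X = counit X \<cdot>\<^bsub>C\<^esub> mul X"

definition copairing :: "('o, 'm, 'k) lin_mon_cat \<Rightarrow> ('o, 'm) frob_alg \<Rightarrow> 'm"
  where "copairing C X = comul X \<cdot>\<^bsub>C\<^esub> unit X"

locale frobenius_object = strict_linear_monoidal_category K C
  for K :: "('k, 'r) ring_scheme" and C :: "('o, 'm, 'k) lin_mon_cat" (structure) +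
  fixes X :: "('o, 'm) frob_alg"
  assumes frobenius: "frobenius_algebra C X"
begin

abbreviation idX :: 'm ("\<iota>") where "\<iota> \<equiv> ident C (ob X)"

lemma ob_closed [simp]: "ob X \<in> Obj C"
  using frobenius by (simp add: frobenius_algebra_def unital_algebra_def)

lemma structure_mor [simp]:
  "mor (mul X)" "source (mul X) = ob X \<boxtimes>\<^sub>o ob X" "target (mul X) = ob X"
  "mor (unit X)" "source (unit X) = unit_obj C" "target (unit X) = ob X"
  "mor (comul X)" "source (comul X) = ob X" "target (comul X) = ob X \<boxtimes>\<^sub>o ob X"
  "mor (counit X)" "source (counit X) = ob X" "target (counit X) = unit_obj C"
  using frobenius unfolding frobenius_algebra_def unital_algebra_def counital_coalgebra_def
  by (simp_all add: hom_set_iff)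

lemma pairing_mor [simp]:
  "mor (pairing C X)" "source (pairing C X) = ob X \<boxtimes>\<^sub>o ob X" "target (pairing C X) = unit_obj C"
  "mor (copairing C X)" "source (copairing C X) = unit_obj C"
  "target (copairing C X) = ob X \<boxtimes>\<^sub>o ob X"
  by (simp_all add: pairing_def copairing_def)

lemma algebra_laws:
  "mul X \<cdot> (mul X \<boxtimes> \<iota>) = mul X \<cdot> (\<iota> \<boxtimes> mul X)"
  "mul X \<cdot> (unit X \<boxtimes> \<iota>) = \<iota>" "mul X \<cdot> (\<iota> \<boxtimes> unit X) = \<iota>"
  "(comul X \<boxtimes> \<iota>) \<cdot> comul X = (\<iota> \<boxtimes> comul X) \<cdot> comul X"
  "(counit X \<boxtimes> \<iota>) \<cdot> comul X = \<iota>" "(\<iota> \<boxtimes> counit X) \<cdot> comul X = \<iota>"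
  "(\<iota> \<boxtimes> mul X) \<cdot> (comul X \<boxtimes> \<iota>) = comul X \<cdot> mul X"
  "(mul X \<boxtimes> \<iota>) \<cdot> (\<iota> \<boxtimes> comul X) = comul X \<cdot> mul X"
  using frobenius unfolding frobenius_algebra_def unital_algebra_def counital_coalgebra_def
  by auto

lemma zigzag:
  "(\<iota> \<boxtimes> pairing C X) \<cdot> (copairing C X \<boxtimes> \<iota>) = \<iota>"
  "(pairing C X \<boxtimes> \<iota>) \<cdot> (\<iota> \<boxtimes> copairing C X) = \<iota>"
  using frob_dual_is_left_dual[OF frobenius]
  by (simp_all add: is_left_dual_def frob_dual_def pairing_def copairing_def)

text \<open>
  The comultiplication is recovered from the copairing by multiplying on either side. All
  calculations below start by replacing it in this way, because morphisms can be slid along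
  a copairing.
\<close>

lemma comul_left: "(\<iota> \<boxtimes> mul X) \<cdot> (copairing C X \<boxtimes> \<iota>) = comul X"
proof -
  have "(\<iota> \<boxtimes> mul X) \<cdot> (copairing C X \<boxtimes> \<iota>)
      = ((\<iota> \<boxtimes> mul X) \<cdot> (comul X \<boxtimes> \<iota>)) \<cdot> (unit X \<boxtimes> \<iota>)"
    by (simp add: copairing_def interchange_mor)
  also have "\<dots> = comul X"
    unfolding algebra_laws(7) by (simp add: algebra_laws)
  finally show ?thesis .
qed

lemma comul_right: "(mul X \<boxtimes> \<iota>) \<cdot> (\<iota> \<boxtimes> copairing C X) = comul X"
proof -
  have "(mul X \<boxtimes> \<iota>) \<cdot> (\<iota> \<boxtimes> copairing C X)
      = ((mul X \<boxtimes> \<iota>) \<cdot> (\<iota> \<boxtimes> comul X)) \<cdot> (\<iota> \<boxtimes> unit X)"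
    by (simp add: copairing_def interchange_mor)
  also have "\<dots> = comul X"
    unfolding algebra_laws(8) by (simp add: algebra_laws)
  finally show ?thesis .
qed

end

context strict_linear_monoidal_category
begin

text \<open>
  A transpose of \<open>f\<close>: along the copairings \<open>f\<close> on the left leg becomes \<open>h\<close> on the right leg. The
  relation is stated by its sliding property because duality will only be used through it. It makes
  \<open>h\<close> the dual of \<open>f\<close>, and \<open>mate Y X h f\<close> makes \<open>f\<close> the dual of \<open>h\<close>; having both is the meaning
  of \<open>f** = f\<close>, which in the absence of a symmetry is a genuine condition.
\<close>

definition mate :: "('o, 'm) frob_alg \<Rightarrow> ('o, 'm) frob_alg \<Rightarrow> 'm \<Rightarrow> 'm \<Rightarrow> bool"
  where "mate X Y f h \<longleftrightarrow> f \<in> hom_set C (ob X) (ob Y) \<and> h \<in> hom_set C (ob Y) (ob X) \<and>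
    (f \<boxtimes> ident C (ob X)) \<cdot> copairing C X = (ident C (ob Y) \<boxtimes> h) \<cdot> copairing C Y"

text \<open>
  The definition of the dual contains \<open>f\<close> on the copairing of \<open>X\<close>, followed by the pairing of \<open>Y\<close>;
  plugging in the copairing of \<open>Y\<close> straightens a zigzag and leaves \<open>f\<close> alone.
\<close>

lemma mate_frob_star:
  assumes "frobenius_algebra C X" "frobenius_algebra C Y" "f \<in> hom_set C (ob X) (ob Y)"
  shows "mate X Y f (frob_star C X Y f)"
proof -
  interpret X: frobenius_object K C X by unfold_locales (fact assms)
  interpret Y: frobenius_object K C Y by unfold_locales (fact assms)
  let ?i = "ident C (ob X)" and ?j = "ident C (ob Y)"
  let ?p = "pairing C Y" and ?c = "copairing C X" and ?d = "copairing C Y"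
  have f [simp]: "mor f" "source f = ob X" "target f = ob Y"
    using assms(3) by (simp_all add: hom_set_iff)
  have star: "frob_star C X Y f = (?p \<boxtimes> ?i) \<cdot> ((?j \<boxtimes> (f \<boxtimes> ?i)) \<cdot> (?j \<boxtimes> ?c))"
    by (simp add: frob_star_def dual_mor_def frob_dual_def
        pairing_def[symmetric] copairing_def[symmetric])
  have star': "frob_star C X Y f = (?p \<boxtimes> ?i) \<cdot> (?j \<boxtimes> ((f \<boxtimes> ?i) \<cdot> ?c))"
    unfolding star by (simp add: interchange_mor)
  have "(?j \<boxtimes> frob_star C X Y f) \<cdot> ?d
      = (?j \<boxtimes> (?p \<boxtimes> ?i)) \<cdot> ((?j \<boxtimes> (?j \<boxtimes> ((f \<boxtimes> ?i) \<cdot> ?c))) \<cdot> ?d)"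
    unfolding star' by (simp add: interchange_mor_assoc del: tens_ident_assoc)
  also have "(?j \<boxtimes> (?j \<boxtimes> ((f \<boxtimes> ?i) \<cdot> ?c))) \<cdot> ?d
      = (ident C (ob Y \<boxtimes>\<^sub>o ob Y) \<boxtimes> ((f \<boxtimes> ?i) \<cdot> ?c)) \<cdot> (?d \<boxtimes> ident C (unit_obj C))"
    by simp
  also have "\<dots> = (?d \<boxtimes> ident C (ob Y \<boxtimes>\<^sub>o ob X)) \<cdot> ((f \<boxtimes> ?i) \<cdot> ?c)"
    using interchange_mor[of ?d "ident C (unit_obj C)" "ident C (ob Y \<boxtimes>\<^sub>o ob X)"
        "(f \<boxtimes> ?i) \<cdot> ?c"]
    by (simp add: interchange_mor del: tens_unit_mor(2))
  also have "(?j \<boxtimes> (?p \<boxtimes> ?i)) \<cdot> \<dots>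
      = ((?j \<boxtimes> ?p) \<boxtimes> ?i) \<cdot> (((?d \<boxtimes> ?j) \<boxtimes> ?i) \<cdot> ((f \<boxtimes> ?i) \<cdot> ?c))"
    by simp
  also have "\<dots> = (f \<boxtimes> ?i) \<cdot> ?c"
    by (subst interchange_mor_assoc) (simp_all del: tens_assoc_mor add: Y.zigzag)
  finally show ?thesis
    using assms(3) unfolding mate_def star' by (simp add: hom_set_iff)
qed

end

section \<open>Convolution products as module endomorphisms\<close>

context strict_linear_monoidal_category
begin

lemma convol_closed:
  assumes "frobenius_algebra C X" "a \<in> hom_set C (ob X) (ob X)" "b \<in> hom_set C (ob X) (ob X)"
  shows "convol C X a b \<in> hom_set C (ob X) (ob X)"
proof -
  interpret X: frobenius_object K C X by unfold_locales (fact assms)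
  show ?thesis using assms(2,3) by (simp add: convol_def hom_set_iff)
qed

text \<open>
  After \<open>h\<close> is slid along the copairing of \<open>Y\<close>, the map \<open>\<phi>\<close> becomes \<open>y \<mapsto> \<Sum> f(u) b(f(v) y)\<close>, where
  \<open>\<Sum> u \<otimes> v\<close> is the copairing of \<open>X\<close>. The claim is then the Casimir property of that copairing,
  \<open>\<Sum> u \<otimes> v x = \<Sum> x u \<otimes> v\<close>, carried through the multiplicative map \<open>f\<close>.
\<close>

lemma convol_left_module:
  assumes X: "frobenius_algebra C X" and Y: "frobenius_algebra C Y"
    and f: "algebra_morphism C X Y f" and adj: "mate Y X h f"
    and b: "b \<in> hom_set C (ob Y) (ob Y)"
  defines "\<phi> \<equiv> convol C Y (f \<cdot> h) b"
  shows "\<phi> \<cdot> (mul Y \<cdot> (f \<boxtimes> ident C (ob Y))) = mul Y \<cdot> (f \<boxtimes> \<phi>)"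
proof -
  interpret X: frobenius_object K C X by unfold_locales (fact X)
  interpret Y: frobenius_object K C Y by unfold_locales (fact Y)
  let ?i = "ident C (ob X)" and ?j = "ident C (ob Y)"
  let ?m = "mul X" and ?n = "mul Y" and ?c = "copairing C X" and ?d = "copairing C Y"
  have f [simp]: "mor f" "source f = ob X" "target f = ob Y"
    and f_mul: "?n \<cdot> (f \<boxtimes> f) = f \<cdot> ?m"
    using f by (simp_all add: algebra_morphism_def hom_set_iff)
  have h [simp]: "mor h" "source h = ob Y" "target h = ob X"
    and slide: "(h \<boxtimes> ?j) \<cdot> ?d = (?i \<boxtimes> f) \<cdot> ?c"
    using adj by (simp_all add: mate_def hom_set_iff)
  have b [simp]: "mor b" "source b = ob Y" "target b = ob Y"
    using b by (simp_all add: hom_set_iff)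
  \<comment> \<open>the action of \<open>X\<close> on \<open>Y\<close> through \<open>f\<close>\<close>
  define act where "act = ?n \<cdot> (f \<boxtimes> ?j)"
  have act [simp]: "mor act" "source act = ob X \<boxtimes>\<^sub>o ob Y" "target act = ob Y"
    by (simp_all add: act_def)
  have act_act: "act \<cdot> (?i \<boxtimes> act) = act \<cdot> (?m \<boxtimes> ?j)"
  proof -
    have "act \<cdot> (?i \<boxtimes> act) = (?n \<cdot> (?j \<boxtimes> ?n)) \<cdot> (f \<boxtimes> (f \<boxtimes> ?j))"
      by (simp add: act_def interchange_mor)
    also have "\<dots> = (?n \<cdot> (?n \<boxtimes> ?j)) \<cdot> ((f \<boxtimes> f) \<boxtimes> ?j)"
      by (simp add: Y.algebra_laws(1))
    also have "\<dots> = act \<cdot> (?m \<boxtimes> ?j)"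
      by (simp add: act_def interchange_mor f_mul del: tens_assoc_mor)
    finally show ?thesis .
  qed
  have phi: "\<phi> = ?n \<cdot> ((f \<boxtimes> (b \<cdot> act)) \<cdot> (?c \<boxtimes> ?j))"
  proof -
    have "\<phi> = ?n \<cdot> (((f \<cdot> h) \<boxtimes> b) \<cdot> ((?j \<boxtimes> ?n) \<cdot> (?d \<boxtimes> ?j)))"
      by (simp add: \<phi>_def convol_def Y.comul_left)
    also have "\<dots> = ?n \<cdot> ((f \<boxtimes> (b \<cdot> ?n)) \<cdot> (((h \<boxtimes> ?j) \<boxtimes> ?j) \<cdot> (?d \<boxtimes> ?j)))"
      by (simp add: interchange_mor_assoc)
    also have "((h \<boxtimes> ?j) \<boxtimes> ?j) \<cdot> (?d \<boxtimes> ?j) = ((?i \<boxtimes> f) \<boxtimes> ?j) \<cdot> (?c \<boxtimes> ?j)"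
      by (simp add: interchange_mor slide del: tens_assoc_mor)
    also have "(f \<boxtimes> (b \<cdot> ?n)) \<cdot> \<dots> = (f \<boxtimes> (b \<cdot> act)) \<cdot> (?c \<boxtimes> ?j)"
      by (simp add: interchange_mor_assoc act_def)
    finally show ?thesis .
  qed
  have "\<phi> \<cdot> act = ?n \<cdot> ((f \<boxtimes> (b \<cdot> act)) \<cdot> ((?c \<boxtimes> ?j) \<cdot> (ident C (unit_obj C) \<boxtimes> act)))"
    unfolding phi by simp
  also have "(?c \<boxtimes> ?j) \<cdot> (ident C (unit_obj C) \<boxtimes> act)
      = (?i \<boxtimes> (?i \<boxtimes> act)) \<cdot> (?c \<boxtimes> (?i \<boxtimes> ?j))"
    by (simp add: interchange_mor del: tens_unit_mor)
  also have "(f \<boxtimes> (b \<cdot> act)) \<cdot> \<dots>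
      = (f \<boxtimes> (b \<cdot> (act \<cdot> (?i \<boxtimes> act)))) \<cdot> (?c \<boxtimes> (?i \<boxtimes> ?j))"
    by (simp add: interchange_mor_assoc del: tens_ident_assoc)
  also have "\<dots> = (f \<boxtimes> (b \<cdot> act)) \<cdot> (((?i \<boxtimes> ?m) \<boxtimes> ?j) \<cdot> ((?c \<boxtimes> ?i) \<boxtimes> ?j))"
    unfolding act_act by (simp add: interchange_mor_assoc)
  \<comment> \<open>the Casimir property: both sides are the comultiplication of \<open>X\<close>\<close>
  also have "((?i \<boxtimes> ?m) \<boxtimes> ?j) \<cdot> ((?c \<boxtimes> ?i) \<boxtimes> ?j) = ((?m \<boxtimes> ?i) \<boxtimes> ?j) \<cdot> ((?i \<boxtimes> ?c) \<boxtimes> ?j)"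
    by (simp add: interchange_mor X.comul_left X.comul_right del: tens_assoc_mor)
  also have "(f \<boxtimes> (b \<cdot> act)) \<cdot> \<dots> = ((f \<cdot> ?m) \<boxtimes> (b \<cdot> act)) \<cdot> (?i \<boxtimes> (?c \<boxtimes> ?j))"
    by (simp add: interchange_mor_assoc)
  also have "(f \<cdot> ?m) \<boxtimes> (b \<cdot> act) = (?n \<boxtimes> ?j) \<cdot> (f \<boxtimes> (f \<boxtimes> (b \<cdot> act)))"
    using interchange_mor[of ?n "f \<boxtimes> f" ?j "b \<cdot> act"] by (simp add: f_mul)
  also have "?n \<cdot> (\<dots> \<cdot> (?i \<boxtimes> (?c \<boxtimes> ?j)))
      = (?n \<cdot> (?n \<boxtimes> ?j)) \<cdot> (f \<boxtimes> ((f \<boxtimes> (b \<cdot> act)) \<cdot> (?c \<boxtimes> ?j)))"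
    by (simp add: interchange_mor del: tens_ident_assoc)
  also have "\<dots> = ?n \<cdot> (f \<boxtimes> \<phi>)"
    unfolding Y.algebra_laws(1) phi by (simp add: interchange_mor)
  finally show ?thesis by (simp add: act_def)
qed

text \<open>
  The mirror image, with the other direction of sliding.
\<close>

lemma convol_right_module:
  assumes X: "frobenius_algebra C X" and Y: "frobenius_algebra C Y"
    and f: "algebra_morphism C X Y f" and adj: "mate X Y f h"
    and b: "b \<in> hom_set C (ob Y) (ob Y)"
  defines "\<phi> \<equiv> convol C Y b (f \<cdot> h)"
  shows "\<phi> \<cdot> (mul Y \<cdot> (ident C (ob Y) \<boxtimes> f)) = mul Y \<cdot> (\<phi> \<boxtimes> f)"
proof -
  interpret X: frobenius_object K C X by unfold_locales (fact X)
  interpret Y: frobenius_object K C Y by unfold_locales (fact Y)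
  let ?i = "ident C (ob X)" and ?j = "ident C (ob Y)"
  let ?m = "mul X" and ?n = "mul Y" and ?c = "copairing C X" and ?d = "copairing C Y"
  have f [simp]: "mor f" "source f = ob X" "target f = ob Y"
    and f_mul: "?n \<cdot> (f \<boxtimes> f) = f \<cdot> ?m"
    using f by (simp_all add: algebra_morphism_def hom_set_iff)
  have h [simp]: "mor h" "source h = ob Y" "target h = ob X"
    and slide: "(?j \<boxtimes> h) \<cdot> ?d = (f \<boxtimes> ?i) \<cdot> ?c"
    using adj by (simp_all add: mate_def hom_set_iff)
  have b [simp]: "mor b" "source b = ob Y" "target b = ob Y"
    using b by (simp_all add: hom_set_iff)
  define act where "act = ?n \<cdot> (?j \<boxtimes> f)"
  have act [simp]: "mor act" "source act = ob Y \<boxtimes>\<^sub>o ob X" "target act = ob Y"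
    by (simp_all add: act_def)
  have act_act: "act \<cdot> (act \<boxtimes> ?i) = act \<cdot> (?j \<boxtimes> ?m)"
  proof -
    have "act \<cdot> (act \<boxtimes> ?i) = (?n \<cdot> (?n \<boxtimes> ?j)) \<cdot> ((?j \<boxtimes> f) \<boxtimes> f)"
      by (simp add: act_def interchange_mor del: tens_assoc_mor)
    also have "\<dots> = (?n \<cdot> (?j \<boxtimes> ?n)) \<cdot> (?j \<boxtimes> (f \<boxtimes> f))"
      by (simp add: Y.algebra_laws(1))
    also have "\<dots> = act \<cdot> (?j \<boxtimes> ?m)"
      by (simp add: act_def interchange_mor f_mul)
    finally show ?thesis .
  qed
  have phi: "\<phi> = ?n \<cdot> (((b \<cdot> act) \<boxtimes> f) \<cdot> (?j \<boxtimes> ?c))"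
  proof -
    have "\<phi> = ?n \<cdot> ((b \<boxtimes> (f \<cdot> h)) \<cdot> ((?n \<boxtimes> ?j) \<cdot> (?j \<boxtimes> ?d)))"
      by (simp add: \<phi>_def convol_def Y.comul_right)
    also have "\<dots> = ?n \<cdot> (((b \<cdot> ?n) \<boxtimes> f) \<cdot> ((?j \<boxtimes> (?j \<boxtimes> h)) \<cdot> (?j \<boxtimes> ?d)))"
      by (simp add: interchange_mor_assoc)
    also have "(?j \<boxtimes> (?j \<boxtimes> h)) \<cdot> (?j \<boxtimes> ?d) = (?j \<boxtimes> (f \<boxtimes> ?i)) \<cdot> (?j \<boxtimes> ?c)"
      by (simp add: interchange_mor slide del: tens_ident_assoc)
    also have "((b \<cdot> ?n) \<boxtimes> f) \<cdot> \<dots> = ((b \<cdot> ?n) \<boxtimes> f) \<cdot> (((?j \<boxtimes> f) \<boxtimes> ?i) \<cdot> (?j \<boxtimes> ?c))"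
      by simp
    also have "\<dots> = ((b \<cdot> act) \<boxtimes> f) \<cdot> (?j \<boxtimes> ?c)"
      by (simp add: interchange_mor_assoc act_def del: tens_assoc_mor)
    finally show ?thesis .
  qed
  have "\<phi> \<cdot> act = ?n \<cdot> (((b \<cdot> act) \<boxtimes> f) \<cdot> ((?j \<boxtimes> ?c) \<cdot> (act \<boxtimes> ident C (unit_obj C))))"
    unfolding phi by simp
  also have "(?j \<boxtimes> ?c) \<cdot> (act \<boxtimes> ident C (unit_obj C))
      = ((act \<boxtimes> ?i) \<boxtimes> ?i) \<cdot> (?j \<boxtimes> (?i \<boxtimes> ?c))"
    by (simp add: interchange_mor del: tens_unit_mor)
  also have "((b \<cdot> act) \<boxtimes> f) \<cdot> \<dots>
      = ((b \<cdot> (act \<cdot> (act \<boxtimes> ?i))) \<boxtimes> f) \<cdot> (?j \<boxtimes> (?i \<boxtimes> ?c))"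
    by (simp add: interchange_mor_assoc del: tens_assoc_mor)
  also have "\<dots> = ((b \<cdot> act) \<boxtimes> f) \<cdot> (((?j \<boxtimes> ?m) \<boxtimes> ?i) \<cdot> (?j \<boxtimes> (?i \<boxtimes> ?c)))"
    unfolding act_act by (simp add: interchange_mor_assoc del: tens_assoc_mor)
  also have "((?j \<boxtimes> ?m) \<boxtimes> ?i) \<cdot> (?j \<boxtimes> (?i \<boxtimes> ?c)) = (?j \<boxtimes> (?m \<boxtimes> ?i)) \<cdot> (?j \<boxtimes> (?i \<boxtimes> ?c))"
    by simp
  also have "\<dots> = (?j \<boxtimes> (?i \<boxtimes> ?m)) \<cdot> (?j \<boxtimes> (?c \<boxtimes> ?i))"
    by (simp add: interchange_mor X.comul_left X.comul_right del: tens_ident_assoc)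
  also have "((b \<cdot> act) \<boxtimes> f) \<cdot> \<dots> = ((b \<cdot> act) \<boxtimes> (f \<cdot> ?m)) \<cdot> ((?j \<boxtimes> ?c) \<boxtimes> ?i)"
    by (simp add: interchange_mor_assoc)
  also have "(b \<cdot> act) \<boxtimes> (f \<cdot> ?m) = (?j \<boxtimes> ?n) \<cdot> (((b \<cdot> act) \<boxtimes> f) \<boxtimes> f)"
    using interchange_mor[of ?j "b \<cdot> act" ?n "f \<boxtimes> f"] by (simp add: f_mul)
  also have "?n \<cdot> (\<dots> \<cdot> ((?j \<boxtimes> ?c) \<boxtimes> ?i))
      = (?n \<cdot> (?j \<boxtimes> ?n)) \<cdot> ((((b \<cdot> act) \<boxtimes> f) \<cdot> (?j \<boxtimes> ?c)) \<boxtimes> f)"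
    by (simp add: interchange_mor del: tens_assoc_mor)
  also have "\<dots> = ?n \<cdot> (\<phi> \<boxtimes> f)"
    unfolding Y.algebra_laws(1)[symmetric] phi by (simp add: interchange_mor)
  finally show ?thesis by (simp add: act_def)
qed

end

section \<open>Scalars and connectedness\<close>

context strict_linear_monoidal_category
begin

text \<open>
  The scalar action with the hom space read off from the morphism, so that bilinearity of
  composition and tensor product can be used as rewriting without naming any hom space.
\<close>

definition scale :: "'k \<Rightarrow> 'm \<Rightarrow> 'm"
  where "scale c f = c \<odot>\<^bsub>Hom C (source f) (target f)\<^esub> f"

lemma mor_scale [simp]:
  assumes "c \<in> carrier K" "mor f"
  shows "mor (scale c f)" "source (scale c f) = source f" "target (scale c f) = target f"
proof -
  interpret V: vectorspace K "Hom C (source f) (target f)"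
    using assms hom_vectorspace by simp
  have "scale c f \<in> hom_set C (source f) (target f)"
    using assms by (simp add: scale_def)
  then show "mor (scale c f)" "source (scale c f) = source f" "target (scale c f) = target f"
    using assms by (simp_all add: hom_set_iff)
qed

lemma scale_scale:
  assumes "c \<in> carrier K" "d \<in> carrier K" "mor f"
  shows "scale c (scale d f) = scale (c \<otimes>\<^bsub>K\<^esub> d) f"
proof -
  interpret V: vectorspace K "Hom C (source f) (target f)"
    using assms hom_vectorspace by simp
  have "scale c (scale d f) = c \<odot>\<^bsub>Hom C (source f) (target f)\<^esub> scale d f"
    using assms by (simp add: scale_def[of c])
  then show ?thesis
    using assms by (simp add: scale_def[of d] scale_def[of "c \<otimes>\<^bsub>K\<^esub> d"] V.smult_assoc1)
qed

lemma scale_one: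
  assumes "mor f"
  shows "scale \<one>\<^bsub>K\<^esub> f = f"
proof -
  interpret V: vectorspace K "Hom C (source f) (target f)"
    using assms hom_vectorspace by simp
  show ?thesis using assms by (simp add: scale_def)
qed

lemma scale_comp:
  assumes "c \<in> carrier K" "mor g" "mor f" "target f = source g"
  shows "g \<cdot> scale c f = scale c (g \<cdot> f)" "scale c g \<cdot> f = scale c (g \<cdot> f)"
proof -
  show "g \<cdot> scale c f = scale c (g \<cdot> f)"
    using module_hom_smult[OF comp_linear_right[of "source f" "target f" "target g" g], of c f]
      assms morD[of g] morD[of f] by (simp add: scale_def)
  show "scale c g \<cdot> f = scale c (g \<cdot> f)"
    using module_hom_smult[OF comp_linear_left[of "source f" "target f" "target g" f], of c g]
      assms morD[of g] morD[of f] by (simp add: scale_def)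
qed

lemma scale_tens:
  assumes "c \<in> carrier K" "mor f" "mor g"
  shows "f \<boxtimes> scale c g = scale c (f \<boxtimes> g)" "scale c f \<boxtimes> g = scale c (f \<boxtimes> g)"
proof -
  show "f \<boxtimes> scale c g = scale c (f \<boxtimes> g)"
    using module_hom_smult[OF tens_linear_right[of "source f" "target f" "source g" "target g" f],
        of c g] assms by (simp add: scale_def)
  show "scale c f \<boxtimes> g = scale c (f \<boxtimes> g)"
    using module_hom_smult[OF tens_linear_left[of "source f" "target f" "source g" "target g" g],
        of c f] assms by (simp add: scale_def)
qed

lemma scalar_mor_scale: "scalar_mor C c = scale c (ident C (unit_obj C))"
  by (simp add: scalar_mor_def scale_def)

lemma scalar_of_unit_endo:
  assumes "linear_simple_unit K C" "u \<in> hom_set C (unit_obj C) (unit_obj C)"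
  shows "scalar_of K C u \<in> carrier K" "scale (scalar_of K C u) (ident C (unit_obj C)) = u"
proof -
  have b: "inj_on (scalar_mor C) (carrier K)"
    "scalar_mor C ` carrier K = hom_set C (unit_obj C) (unit_obj C)"
    using assms(1) by (simp_all add: linear_simple_unit_def bij_betw_def)
  show "scalar_of K C u \<in> carrier K"
    unfolding scalar_of_def by (rule the_inv_into_into[OF b(1)]) (use b(2) assms(2) in auto)
  show "scale (scalar_of K C u) (ident C (unit_obj C)) = u"
    unfolding scalar_of_def scalar_mor_scale[symmetric]
    by (rule f_the_inv_into_f[OF b(1)]) (use b(2) assms(2) in auto)
qed

lemma scalar_of_scalar:
  assumes "linear_simple_unit K C" "c \<in> carrier K"
  shows "scalar_of K C (scale c (ident C (unit_obj C))) = c"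
  using assms the_inv_into_f_f[of "scalar_mor C" "carrier K" c]
  by (simp add: scalar_of_def scalar_mor_scale linear_simple_unit_def bij_betw_def)

lemma scalar_of_scale:
  assumes "linear_simple_unit K C" "mor u" "source u = unit_obj C" "target u = unit_obj C"
    and "c \<in> carrier K"
  shows "scalar_of K C (scale c u) = c \<otimes>\<^bsub>K\<^esub> scalar_of K C u"
proof -
  interpret R: field K by (fact field_K)
  have "u \<in> hom_set C (unit_obj C) (unit_obj C)" using assms by (simp add: hom_set_iff)
  note u = scalar_of_unit_endo[OF assms(1) this]
  have "scale c u = scale (c \<otimes>\<^bsub>K\<^esub> scalar_of K C u) (ident C (unit_obj C))"
    using u assms(5) scale_scale[of c "scalar_of K C u" "ident C (unit_obj C)"] by simp
  then show ?thesis using assms(1,5) u(1) by (simp add: scalar_of_scalar)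
qed

end

lemma (in vectorspace) one_dim_generator:
  assumes "fin_dim" "dim = 1"
  shows "\<exists>v\<in>carrier V. \<forall>x\<in>carrier V. \<exists>a\<in>carrier K. x = a \<odot>\<^bsub>V\<^esub> v"
proof -
  obtain B where B: "finite B" "basis B" using assms finite_basis_exists by blast
  then have "card B = 1" using assms dim_basis by simp
  then obtain v where v: "B = {v}" by (auto simp: card_1_singleton_iff)
  have vV: "v \<in> carrier V" and span: "span {v} = carrier V"
    using B(2) v by (auto simp: basis_def)
  have "\<exists>a\<in>carrier K. x = a \<odot>\<^bsub>V\<^esub> v" if "x \<in> carrier V" for x
  proof -
    have "x \<in> {lincomb a {v} | a. a \<in> {v} \<rightarrow> carrier K}"
      using that vV span finite_span[of "{v}"] by simp
    then obtain a where "a \<in> {v} \<rightarrow> carrier K" "x = lincomb a {v}" by blast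
    then show ?thesis using vV by (auto simp: lincomb_def)
  qed
  then show ?thesis using vV by blast
qed

context strict_linear_monoidal_category
begin

text \<open>
  Both sides are bilinear in \<open>x\<close> and the unit, and both of these are multiples of one generator
  \<open>v\<close>; for \<open>x = a v\<close> and \<open>e = b v\<close> each side is \<open>a b (\<epsilon> v) v\<close>. Stating it with the factor \<open>\<mu>\<close>
  covers the case \<open>\<mu> = 0\<close>.
\<close>

lemma connected_exchange:
  assumes simple: "linear_simple_unit K C" and X: "frobenius_algebra C X"
    and conn: "connected_algebra K C X" and x: "x \<in> hom_set C (unit_obj C) (ob X)"
  shows "scale (frob_mu K C X) x = scale (scalar_of K C (counit X \<cdot> x)) (unit X)"
proof -
  interpret X: frobenius_object K C X by unfold_locales (fact X)
  interpret R: field K by (fact field_K)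
  interpret V: vectorspace K "Hom C (unit_obj C) (ob X)"
    by (simp add: hom_vectorspace)
  obtain v where v: "v \<in> hom_set C (unit_obj C) (ob X)"
    and gen: "\<And>y. y \<in> hom_set C (unit_obj C) (ob X) \<Longrightarrow> \<exists>a\<in>carrier K. y = scale a v"
    using V.one_dim_generator conn
    by (fastforce simp: connected_algebra_def scale_def hom_set_iff)
  have v [simp]: "mor v" "source v = unit_obj C" "target v = ob X"
    using v by (simp_all add: hom_set_iff)
  obtain a where a: "a \<in> carrier K" "x = scale a v" using gen[OF x] by blast
  obtain b where b: "b \<in> carrier K" "unit X = scale b v"
    using gen[of "unit X"] by (auto simp: hom_set_iff)
  define c where "c = scalar_of K C (counit X \<cdot> v)"
  have c: "c \<in> carrier K"
    using scalar_of_unit_endo[OF simple] by (simp add: c_def hom_set_iff)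
  have "frob_mu K C X = b \<otimes>\<^bsub>K\<^esub> c"
    using b simple by (simp add: frob_mu_def c_def scale_comp scalar_of_scale)
  moreover have "scalar_of K C (counit X \<cdot> x) = a \<otimes>\<^bsub>K\<^esub> c"
    using a simple by (simp add: c_def scale_comp scalar_of_scale)
  ultimately show ?thesis
    using a b c by (simp add: scale_scale R.m_ac)
qed

end

section \<open>Duality of endomorphisms, convolution and traces\<close>

context strict_linear_monoidal_category
begin

lemma mateD:
  assumes "mate X Y f h" "ob X \<in> Obj C" "ob Y \<in> Obj C"
  shows "mor f" "source f = ob X" "target f = ob Y" "mor h" "source h = ob Y" "target h = ob X"
    "(f \<boxtimes> ident C (ob X)) \<cdot> copairing C X = (ident C (ob Y) \<boxtimes> h) \<cdot> copairing C Y"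
  using assms by (simp_all add: mate_def hom_set_iff)

text \<open>
  Bending the left leg back by the pairing recovers \<open>h\<close> from the common value of the two sides, by
  a zigzag identity.
\<close>

lemma mate_unique:
  assumes Y: "frobenius_algebra C Y" and X: "frobenius_algebra C X"
    and "mate X Y f h" "mate X Y f h'"
  shows "h = h'"
proof -
  interpret X: frobenius_object K C X by unfold_locales (fact X)
  interpret Y: frobenius_object K C Y by unfold_locales (fact Y)
  have recover: "k = (pairing C Y \<boxtimes> ident C (ob X))
      \<cdot> (ident C (ob Y) \<boxtimes> ((f \<boxtimes> ident C (ob X)) \<cdot> copairing C X))"
    if "mate X Y f k" for k
  proof -
    note k [simp] = mateD(1-6)[OF that X.ob_closed Y.ob_closed]
    have "(pairing C Y \<boxtimes> ident C (ob X))
        \<cdot> (ident C (ob Y) \<boxtimes> ((ident C (ob Y) \<boxtimes> k) \<cdot> copairing C Y))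
      = (pairing C Y \<boxtimes> ident C (ob X))
        \<cdot> ((ident C (ob Y \<boxtimes>\<^sub>o ob Y) \<boxtimes> k) \<cdot> (ident C (ob Y) \<boxtimes> copairing C Y))"
      using interchange_mor[of "ident C (ob Y)" "ident C (ob Y)" "ident C (ob Y) \<boxtimes> k"
          "copairing C Y"] by simp
    also have "\<dots> = (ident C (unit_obj C) \<boxtimes> k)
        \<cdot> ((pairing C Y \<boxtimes> ident C (ob Y)) \<cdot> (ident C (ob Y) \<boxtimes> copairing C Y))"
      by (simp add: interchange_mor_assoc del: tens_unit_mor)
    also have "\<dots> = k" by (simp add: Y.zigzag)
    finally show ?thesis
      by (simp add: mateD(7)[OF that X.ob_closed Y.ob_closed])
  qed
  show ?thesis using recover assms(3,4) by metis
qed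

lemma mate_comp:
  assumes "frobenius_algebra C X" "frobenius_algebra C Y" "frobenius_algebra C Z"
    and "mate X Y f h" "mate Y Z f' h'"
  shows "mate X Z (f' \<cdot> f) (h \<cdot> h')"
proof -
  interpret X: frobenius_object K C X by unfold_locales (fact assms)
  interpret Y: frobenius_object K C Y by unfold_locales (fact assms)
  interpret Z: frobenius_object K C Z by unfold_locales (fact assms)
  note f [simp] = mateD(1-6)[OF assms(4) X.ob_closed Y.ob_closed]
    and slide = mateD(7)[OF assms(4) X.ob_closed Y.ob_closed]
  note f' [simp] = mateD(1-6)[OF assms(5) Y.ob_closed Z.ob_closed]
    and slide' = mateD(7)[OF assms(5) Y.ob_closed Z.ob_closed]
  have "((f' \<cdot> f) \<boxtimes> ident C (ob X)) \<cdot> copairing C X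
      = (f' \<boxtimes> ident C (ob X)) \<cdot> ((f \<boxtimes> ident C (ob X)) \<cdot> copairing C X)"
    by (simp add: interchange_mor_assoc)
  also have "\<dots> = (ident C (ob Z) \<boxtimes> h) \<cdot> ((f' \<boxtimes> ident C (ob Y)) \<cdot> copairing C Y)"
    by (simp add: slide interchange_mor_assoc)
  also have "\<dots> = (ident C (ob Z) \<boxtimes> (h \<cdot> h')) \<cdot> copairing C Z"
    by (simp add: slide' interchange_mor_assoc)
  finally show ?thesis by (simp add: mate_def hom_set_iff)
qed

lemma mate_scale:
  assumes "frobenius_algebra C X" "frobenius_algebra C Y" "c \<in> carrier K" "mate X Y f h"
  shows "mate X Y (scale c f) (scale c h)"
proof -
  interpret X: frobenius_object K C X by unfold_locales (fact assms)
  interpret Y: frobenius_object K C Y by unfold_locales (fact assms)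
  show ?thesis
    using assms(3) mateD[OF assms(4) X.ob_closed Y.ob_closed]
    by (simp add: mate_def hom_set_iff scale_tens scale_comp)
qed

text \<open>
  Rotating the diagram of a convolution product by half a turn exchanges its two factors.
  With \<open>\<Sum> u \<otimes> v\<close> the copairing, both sides equal \<open>\<Sum> u \<otimes> b'(v\<^sub>1) a'(v\<^sub>2)\<close>.
\<close>

lemma mate_convol:
  assumes X: "frobenius_algebra C X" and a: "mate X X a a'" and b: "mate X X b b'"
  shows "mate X X (convol C X a b) (convol C X b' a')"
proof -
  interpret X: frobenius_object K C X by unfold_locales (fact X)
  let ?i = "ident C (ob X)" and ?m = "mul X" and ?d = "comul X" and ?c = "copairing C X"
  note [simp] = mateD(1-6)[OF a X.ob_closed X.ob_closed] mateD(1-6)[OF b X.ob_closed X.ob_closed]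
  note slide_a = mateD(7)[OF a X.ob_closed X.ob_closed]
    and slide_b = mateD(7)[OF b X.ob_closed X.ob_closed]
  define q where "q = ?m \<cdot> (b' \<boxtimes> a')"
  have q [simp]: "mor q" "source q = ob X \<boxtimes>\<^sub>o ob X" "target q = ob X"
    by (simp_all add: q_def)
  define w where "w = (?i \<boxtimes> ?m) \<cdot> (((?i \<boxtimes> b') \<cdot> ?c) \<boxtimes> ?i)"
  have w [simp]: "mor w" "source w = ob X" "target w = ob X \<boxtimes>\<^sub>o ob X"
    by (simp_all add: w_def)
  have b_w: "(b \<boxtimes> ?i) \<cdot> ?d = w"
  proof -
    have "(b \<boxtimes> ?i) \<cdot> ?d = (b \<boxtimes> ?i) \<cdot> ((?i \<boxtimes> ?m) \<cdot> (?c \<boxtimes> ?i))"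
      by (simp add: X.comul_left)
    also have "\<dots> = (?i \<boxtimes> ?m) \<cdot> (((b \<boxtimes> ?i) \<boxtimes> ?i) \<cdot> (?c \<boxtimes> ?i))"
      by (simp add: interchange_mor_assoc)
    also have "((b \<boxtimes> ?i) \<boxtimes> ?i) \<cdot> (?c \<boxtimes> ?i) = ((?i \<boxtimes> b') \<cdot> ?c) \<boxtimes> ?i"
      by (simp add: interchange_mor slide_b del: tens_assoc_mor)
    finally show ?thesis by (simp add: w_def)
  qed
  have w_a: "w \<cdot> a' = (?i \<boxtimes> q) \<cdot> (?c \<boxtimes> ?i)"
  proof -
    have "w \<cdot> a' = (?i \<boxtimes> ?m) \<cdot> ((((?i \<boxtimes> b') \<cdot> ?c) \<boxtimes> ?i) \<cdot> (ident C (unit_obj C) \<boxtimes> a'))"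
      by (simp add: w_def)
    also have "\<dots> = (?i \<boxtimes> ?m) \<cdot> (((?i \<boxtimes> b') \<boxtimes> a') \<cdot> (?c \<boxtimes> ?i))"
      by (simp add: interchange_mor del: tens_unit_mor tens_assoc_mor)
    also have "\<dots> = (?i \<boxtimes> q) \<cdot> (?c \<boxtimes> ?i)"
      by (simp add: q_def interchange_mor_assoc)
    finally show ?thesis .
  qed
  have coprod: "(?d \<boxtimes> ?i) \<cdot> ?c = (?i \<boxtimes> ?d) \<cdot> ?c"
  proof -
    have "(?d \<boxtimes> ?i) \<cdot> ?c = ((?d \<boxtimes> ?i) \<cdot> ?d) \<cdot> unit X"
      by (simp add: copairing_def)
    then show ?thesis by (simp add: X.algebra_laws(4) copairing_def)
  qed
  have "(convol C X a b \<boxtimes> ?i) \<cdot> ?c = (?m \<boxtimes> ?i) \<cdot> ((a \<boxtimes> (b \<boxtimes> ?i)) \<cdot> ((?d \<boxtimes> ?i) \<cdot> ?c))"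
    using interchange_mor_assoc[of "a \<boxtimes> b" ?d ?i ?i ?c]
    by (simp add: convol_def interchange_mor_assoc)
  also have "(a \<boxtimes> (b \<boxtimes> ?i)) \<cdot> ((?d \<boxtimes> ?i) \<cdot> ?c) = (?i \<boxtimes> w) \<cdot> ((a \<boxtimes> ?i) \<cdot> ?c)"
    by (simp add: coprod interchange_mor_assoc b_w)
  also have "\<dots> = (?i \<boxtimes> ((?i \<boxtimes> q) \<cdot> (?c \<boxtimes> ?i))) \<cdot> ?c"
    by (simp add: slide_a interchange_mor_assoc w_a)
  also have "\<dots> = (?i \<boxtimes> (?i \<boxtimes> q)) \<cdot> (((?i \<boxtimes> ?c) \<boxtimes> ?i) \<cdot> ?c)"
    by (simp add: interchange_mor_assoc del: tens_ident_assoc)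
  also have "(?m \<boxtimes> ?i) \<cdot> \<dots> = (?i \<boxtimes> q) \<cdot> (((?m \<boxtimes> ?i) \<boxtimes> ?i) \<cdot> (((?i \<boxtimes> ?c) \<boxtimes> ?i) \<cdot> ?c))"
    by (simp add: interchange_mor_assoc)
  also have "((?m \<boxtimes> ?i) \<boxtimes> ?i) \<cdot> (((?i \<boxtimes> ?c) \<boxtimes> ?i) \<cdot> ?c) = (?d \<boxtimes> ?i) \<cdot> ?c"
    by (simp add: interchange_mor_assoc X.comul_right del: tens_assoc_mor)
  also have "(?i \<boxtimes> q) \<cdot> ((?d \<boxtimes> ?i) \<cdot> ?c) = (?i \<boxtimes> convol C X b' a') \<cdot> ?c"
    by (simp add: coprod convol_def q_def interchange_mor_assoc)
  finally show ?thesis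
    by (simp add: mate_def hom_set_iff convol_def)
qed

lemma convol_assoc:
  assumes X: "frobenius_algebra C X" and "a \<in> hom_set C (ob X) (ob X)"
    "b \<in> hom_set C (ob X) (ob X)" "c \<in> hom_set C (ob X) (ob X)"
  shows "convol C X (convol C X a b) c = convol C X a (convol C X b c)"
proof -
  interpret X: frobenius_object K C X by unfold_locales (fact X)
  have [simp]: "mor a" "source a = ob X" "target a = ob X" "mor b" "source b = ob X"
    "target b = ob X" "mor c" "source c = ob X" "target c = ob X"
    using assms(2-4) by (simp_all add: hom_set_iff)
  let ?i = "ident C (ob X)" and ?m = "mul X" and ?d = "comul X"
  have "convol C X (convol C X a b) c = (?m \<cdot> (?m \<boxtimes> ?i)) \<cdot> (((a \<boxtimes> b) \<boxtimes> c) \<cdot> ((?d \<boxtimes> ?i) \<cdot> ?d))"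
    by (simp add: convol_def interchange_mor_assoc del: tens_assoc_mor)
  also have "\<dots> = (?m \<cdot> (?i \<boxtimes> ?m)) \<cdot> ((a \<boxtimes> (b \<boxtimes> c)) \<cdot> ((?i \<boxtimes> ?d) \<cdot> ?d))"
    by (simp add: X.algebra_laws)
  also have "\<dots> = convol C X a (convol C X b c)"
    by (simp add: convol_def interchange_mor_assoc)
  finally show ?thesis .
qed

text \<open>
  Placing \<open>a\<close> on the left leg of the copairing and multiplying the legs is \<open>(a * id) e\<close>; through this
  formula traces enter the algebra of convolutions.
\<close>

lemma frob_tr_eq:
  assumes X: "frobenius_algebra C X" and "a \<in> hom_set C (ob X) (ob X)"
  shows "frob_tr K C X a
      = scalar_of K C (counit X \<cdot> (convol C X a (ident C (ob X)) \<cdot> unit X))"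
proof -
  interpret X: frobenius_object K C X by unfold_locales (fact X)
  have [simp]: "mor a" "source a = ob X" "target a = ob X"
    using assms(2) by (simp_all add: hom_set_iff)
  show ?thesis by (simp add: frob_tr_def trace_def frob_dual_def convol_def)
qed

lemma frob_tr_closed:
  assumes "linear_simple_unit K C" "frobenius_algebra C X" "a \<in> hom_set C (ob X) (ob X)"
  shows "frob_tr K C X a \<in> carrier K"
proof -
  interpret X: frobenius_object K C X by unfold_locales (fact assms)
  show ?thesis
    using scalar_of_unit_endo[OF assms(1)] convol_closed[OF assms(2,3), of "ident C (ob X)"]
    unfolding frob_tr_eq[OF assms(2,3)] by (simp add: hom_set_iff)
qed

lemma frob_mu_closed:
  assumes "linear_simple_unit K C" "frobenius_algebra C X"
  shows "frob_mu K C X \<in> carrier K"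
proof -
  interpret X: frobenius_object K C X by unfold_locales (fact assms)
  show ?thesis
    using scalar_of_unit_endo[OF assms(1)] by (simp add: frob_mu_def hom_set_iff)
qed

lemma frob_tr_scale:
  assumes "linear_simple_unit K C" "frobenius_algebra C X" "a \<in> hom_set C (ob X) (ob X)"
    "c \<in> carrier K"
  shows "frob_tr K C X (scale c a) = c \<otimes>\<^bsub>K\<^esub> frob_tr K C X a"
proof -
  interpret X: frobenius_object K C X by unfold_locales (fact assms)
  have a [simp]: "mor a" "source a = ob X" "target a = ob X"
    using assms(3) by (simp_all add: hom_set_iff)
  have "scale c a \<in> hom_set C (ob X) (ob X)" using assms(4) by (simp add: hom_set_iff)
  then show ?thesis
    using assms by (simp add: frob_tr_eq convol_def scale_tens scale_comp scalar_of_scale)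
qed

end

section \<open>Absorption and traces in a connected algebra\<close>

context strict_linear_monoidal_category
begin

text \<open>
  Evaluate the module property on the unit: \<open>\<phi> f = n (f \<otimes> \<phi> e)\<close>, with \<open>n\<close> the multiplication
  of \<open>Y\<close> and \<open>e\<close> its unit, and connectedness replaces \<open>\<mu> \<phi> e\<close> by a multiple of \<open>e\<close>.
\<close>

lemma convol_left_absorb:
  assumes simple: "linear_simple_unit K C" and Y: "frobenius_algebra C Y"
    and conn: "connected_algebra K C Y" and X: "frobenius_algebra C X"
    and f: "algebra_morphism C X Y f" and adj: "mate Y X h f"
    and b: "b \<in> hom_set C (ob Y) (ob Y)"
  defines "\<phi> \<equiv> convol C Y (f \<cdot> h) b"
  shows "scale (frob_mu K C Y) (\<phi> \<cdot> f) = scale (scalar_of K C (counit Y \<cdot> (\<phi> \<cdot> unit Y))) f"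
proof -
  interpret X: frobenius_object K C X by unfold_locales (fact X)
  interpret Y: frobenius_object K C Y by unfold_locales (fact Y)
  let ?\<mu> = "frob_mu K C Y" and ?s = "scalar_of K C (counit Y \<cdot> (\<phi> \<cdot> unit Y))"
  note [simp] = mateD(1-6)[OF adj Y.ob_closed X.ob_closed]
  have "\<phi> \<in> hom_set C (ob Y) (ob Y)"
    unfolding \<phi>_def by (intro convol_closed[OF Y _ b]) (simp add: hom_set_iff)
  then have [simp]: "mor \<phi>" "source \<phi> = ob Y" "target \<phi> = ob Y"
    by (simp_all add: hom_set_iff)
  have [simp]: "?\<mu> \<in> carrier K" "?s \<in> carrier K"
    using frob_mu_closed[OF simple Y] scalar_of_unit_endo[OF simple] by (simp_all add: hom_set_iff)
  have unit_act: "mul Y \<cdot> (f \<boxtimes> unit Y) = f"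
  proof -
    have "mul Y \<cdot> (f \<boxtimes> unit Y)
        = (mul Y \<cdot> (ident C (ob Y) \<boxtimes> unit Y)) \<cdot> (f \<boxtimes> ident C (unit_obj C))"
      by (simp add: interchange_mor del: tens_unit_mor)
    then show ?thesis by (simp add: Y.algebra_laws)
  qed
  have "\<phi> \<cdot> f = \<phi> \<cdot> ((mul Y \<cdot> (f \<boxtimes> ident C (ob Y))) \<cdot> (ident C (ob X) \<boxtimes> unit Y))"
    by (simp add: interchange_mor unit_act)
  also have "\<dots> = (\<phi> \<cdot> (mul Y \<cdot> (f \<boxtimes> ident C (ob Y)))) \<cdot> (ident C (ob X) \<boxtimes> unit Y)"
    by simp
  also have "\<dots> = mul Y \<cdot> (f \<boxtimes> (\<phi> \<cdot> unit Y))"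
    using convol_left_module[OF X Y f adj b] by (simp add: \<phi>_def[symmetric] interchange_mor)
  finally have "scale ?\<mu> (\<phi> \<cdot> f) = mul Y \<cdot> (f \<boxtimes> scale ?\<mu> (\<phi> \<cdot> unit Y))"
    by (simp add: scale_tens scale_comp)
  also have "scale ?\<mu> (\<phi> \<cdot> unit Y) = scale ?s (unit Y)"
    by (rule connected_exchange[OF simple Y conn]) (simp add: hom_set_iff)
  also have "mul Y \<cdot> (f \<boxtimes> \<dots>) = scale ?s f"
    by (simp add: scale_tens scale_comp unit_act)
  finally show ?thesis .
qed

lemma convol_right_absorb:
  assumes simple: "linear_simple_unit K C" and Y: "frobenius_algebra C Y"
    and conn: "connected_algebra K C Y" and X: "frobenius_algebra C X"
    and f: "algebra_morphism C X Y f" and adj: "mate X Y f h"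
    and b: "b \<in> hom_set C (ob Y) (ob Y)"
  defines "\<phi> \<equiv> convol C Y b (f \<cdot> h)"
  shows "scale (frob_mu K C Y) (\<phi> \<cdot> f) = scale (scalar_of K C (counit Y \<cdot> (\<phi> \<cdot> unit Y))) f"
proof -
  interpret X: frobenius_object K C X by unfold_locales (fact X)
  interpret Y: frobenius_object K C Y by unfold_locales (fact Y)
  let ?\<mu> = "frob_mu K C Y" and ?s = "scalar_of K C (counit Y \<cdot> (\<phi> \<cdot> unit Y))"
  note [simp] = mateD(1-6)[OF adj X.ob_closed Y.ob_closed]
  have "\<phi> \<in> hom_set C (ob Y) (ob Y)"
    unfolding \<phi>_def by (intro convol_closed[OF Y b]) (simp add: hom_set_iff)
  then have [simp]: "mor \<phi>" "source \<phi> = ob Y" "target \<phi> = ob Y"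
    by (simp_all add: hom_set_iff)
  have [simp]: "?\<mu> \<in> carrier K" "?s \<in> carrier K"
    using frob_mu_closed[OF simple Y] scalar_of_unit_endo[OF simple] by (simp_all add: hom_set_iff)
  have unit_act: "mul Y \<cdot> (unit Y \<boxtimes> f) = f"
  proof -
    have "mul Y \<cdot> (unit Y \<boxtimes> f)
        = (mul Y \<cdot> (unit Y \<boxtimes> ident C (ob Y))) \<cdot> (ident C (unit_obj C) \<boxtimes> f)"
      by (simp add: interchange_mor del: tens_unit_mor)
    then show ?thesis by (simp add: Y.algebra_laws)
  qed
  have "\<phi> \<cdot> f = \<phi> \<cdot> ((mul Y \<cdot> (ident C (ob Y) \<boxtimes> f)) \<cdot> (unit Y \<boxtimes> ident C (ob X)))"
    by (simp add: interchange_mor unit_act)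
  also have "\<dots> = (\<phi> \<cdot> (mul Y \<cdot> (ident C (ob Y) \<boxtimes> f))) \<cdot> (unit Y \<boxtimes> ident C (ob X))"
    by simp
  also have "\<dots> = mul Y \<cdot> ((\<phi> \<cdot> unit Y) \<boxtimes> f)"
    using convol_right_module[OF X Y f adj b] by (simp add: \<phi>_def[symmetric] interchange_mor)
  finally have "scale ?\<mu> (\<phi> \<cdot> f) = mul Y \<cdot> (scale ?\<mu> (\<phi> \<cdot> unit Y) \<boxtimes> f)"
    by (simp add: scale_tens scale_comp)
  also have "scale ?\<mu> (\<phi> \<cdot> unit Y) = scale ?s (unit Y)"
    by (rule connected_exchange[OF simple Y conn]) (simp add: hom_set_iff)
  also have "mul Y \<cdot> (\<dots> \<boxtimes> f) = scale ?s f"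
    by (simp add: scale_tens scale_comp unit_act)
  finally show ?thesis .
qed

text \<open>
  The absorption property for the identity of \<open>X\<close>, regarded as a self-dual algebra morphism.
\<close>

lemma convol_ident_scalar:
  assumes simple: "linear_simple_unit K C" and X: "frobenius_algebra C X"
    and conn: "connected_algebra K C X" and a: "a \<in> hom_set C (ob X) (ob X)"
  shows "scale (frob_mu K C X) (convol C X a (ident C (ob X)))
      = scale (frob_tr K C X a) (ident C (ob X))"
proof -
  interpret X: frobenius_object K C X by unfold_locales (fact X)
  let ?i = "ident C (ob X)"
  have i: "?i \<in> hom_set C (ob X) (ob X)" by (simp add: hom_set_iff)
  have mate: "mate X X ?i ?i" and alg: "algebra_morphism C X X ?i"
    by (simp_all add: mate_def algebra_morphism_def hom_set_iff)
  show ?thesis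
    using convol_right_absorb[OF simple X conn X alg mate a] convol_closed[OF X a i]
    by (simp add: frob_tr_eq[OF X a] hom_set_iff)
qed

text \<open>
  By associativity \<open>(a * b) * id = a * (b * id)\<close>, and \<open>\<mu> (b * id)\<close> is the scalar \<open>tr b\<close>.
\<close>

lemma frob_tr_convol:
  assumes simple: "linear_simple_unit K C" and X: "frobenius_algebra C X"
    and conn: "connected_algebra K C X"
    and a: "a \<in> hom_set C (ob X) (ob X)" and b: "b \<in> hom_set C (ob X) (ob X)"
  shows "frob_mu K C X \<otimes>\<^bsub>K\<^esub> frob_tr K C X (convol C X a b)
      = frob_tr K C X a \<otimes>\<^bsub>K\<^esub> frob_tr K C X b"
proof -
  interpret X: frobenius_object K C X by unfold_locales (fact X)
  interpret R: field K by (fact field_K)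
  let ?i = "ident C (ob X)" and ?\<mu> = "frob_mu K C X" and ?tr = "frob_tr K C X"
  have i: "?i \<in> hom_set C (ob X) (ob X)" by (simp add: hom_set_iff)
  define \<psi> where "\<psi> = convol C X b ?i"
  have "\<psi> \<in> hom_set C (ob X) (ob X)" unfolding \<psi>_def by (rule convol_closed[OF X b i])
  then have [simp]: "mor \<psi>" "source \<psi> = ob X" "target \<psi> = ob X"
    "mor a" "source a = ob X" "target a = ob X"
    using a by (simp_all add: hom_set_iff)
  have [simp]: "?\<mu> \<in> carrier K" "?tr a \<in> carrier K" "?tr b \<in> carrier K"
    using frob_mu_closed[OF simple X] frob_tr_closed[OF simple X] a b by simp_all
  have "?\<mu> \<otimes>\<^bsub>K\<^esub> ?tr (convol C X a b)
      = ?\<mu> \<otimes>\<^bsub>K\<^esub> scalar_of K C (counit X \<cdot> (convol C X a \<psi> \<cdot> unit X))"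
    by (simp add: frob_tr_eq[OF X convol_closed[OF X a b]] convol_assoc[OF X a b i] \<psi>_def)
  also have "\<dots> = scalar_of K C (counit X \<cdot> (convol C X a (scale ?\<mu> \<psi>) \<cdot> unit X))"
    by (simp add: convol_def scale_tens scale_comp scalar_of_scale simple)
  also have "scale ?\<mu> \<psi> = scale (?tr b) ?i"
    unfolding \<psi>_def by (rule convol_ident_scalar[OF simple X conn b])
  also have "scalar_of K C (counit X \<cdot> (convol C X a (scale (?tr b) ?i) \<cdot> unit X))
      = ?tr b \<otimes>\<^bsub>K\<^esub> ?tr a"
    by (simp add: frob_tr_eq[OF X a] convol_def scale_tens scale_comp scalar_of_scale simple)
  finally show ?thesis by (simp add: R.m_comm)
qed

text \<open>
  Sliding \<open>b\<close> to the other leg of the copairing turns a trace of a composite into \<open>\<epsilon> (a * b') e\<close>.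
\<close>

lemma frob_tr_comp_mate:
  assumes X: "frobenius_algebra C X" and a: "a \<in> hom_set C (ob X) (ob X)"
    and mate: "mate X X b b'"
  shows "frob_tr K C X (a \<cdot> b) = scalar_of K C (counit X \<cdot> (convol C X a b' \<cdot> unit X))"
proof -
  interpret X: frobenius_object K C X by unfold_locales (fact X)
  let ?i = "ident C (ob X)" and ?c = "copairing C X"
  note [simp] = mateD(1-6)[OF mate X.ob_closed X.ob_closed]
    and slide = mateD(7)[OF mate X.ob_closed X.ob_closed]
  have [simp]: "mor a" "source a = ob X" "target a = ob X"
    using a by (simp_all add: hom_set_iff)
  have "((a \<cdot> b) \<boxtimes> ?i) \<cdot> ?c = (a \<boxtimes> ?i) \<cdot> ((b \<boxtimes> ?i) \<cdot> ?c)"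
    by (simp add: interchange_mor_assoc)
  also have "\<dots> = (a \<boxtimes> b') \<cdot> ?c"
    by (simp add: slide interchange_mor_assoc)
  finally have eq: "((a \<cdot> b) \<boxtimes> ?i) \<cdot> (comul X \<cdot> unit X) = (a \<boxtimes> b') \<cdot> (comul X \<cdot> unit X)"
    by (simp add: copairing_def)
  show ?thesis by (simp add: frob_tr_def trace_def frob_dual_def convol_def eq)
qed

text \<open>
  Close both legs of the copairing by the counit: \<open>(\<epsilon> \<otimes> \<epsilon>)\<close> applied to the defining equation.
\<close>

lemma mate_counit_unit:
  assumes X: "frobenius_algebra C X" and mate: "mate X X a a'"
  shows "counit X \<cdot> (a \<cdot> unit X) = counit X \<cdot> (a' \<cdot> unit X)"
proof -
  interpret X: frobenius_object K C X by unfold_locales (fact X)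
  let ?i = "ident C (ob X)" and ?\<epsilon> = "counit X" and ?c = "copairing C X"
  note [simp] = mateD(1-6)[OF mate X.ob_closed X.ob_closed]
    and slide = mateD(7)[OF mate X.ob_closed X.ob_closed]
  have left: "(?i \<boxtimes> ?\<epsilon>) \<cdot> ?c = unit X" and right: "(?\<epsilon> \<boxtimes> ?i) \<cdot> ?c = unit X"
  proof -
    have "(?i \<boxtimes> ?\<epsilon>) \<cdot> ?c = ((?i \<boxtimes> ?\<epsilon>) \<cdot> comul X) \<cdot> unit X"
      and "(?\<epsilon> \<boxtimes> ?i) \<cdot> ?c = ((?\<epsilon> \<boxtimes> ?i) \<cdot> comul X) \<cdot> unit X"
      by (simp_all add: copairing_def)
    then show "(?i \<boxtimes> ?\<epsilon>) \<cdot> ?c = unit X" "(?\<epsilon> \<boxtimes> ?i) \<cdot> ?c = unit X"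
      by (simp_all add: X.algebra_laws)
  qed
  have "?\<epsilon> \<cdot> (a \<cdot> unit X) = ((?\<epsilon> \<cdot> a) \<boxtimes> ident C (unit_obj C)) \<cdot> ((?i \<boxtimes> ?\<epsilon>) \<cdot> ?c)"
    by (simp add: left)
  also have "\<dots> = (?\<epsilon> \<boxtimes> ?\<epsilon>) \<cdot> ((a \<boxtimes> ?i) \<cdot> ?c)"
    by (simp add: interchange_mor_assoc del: tens_unit_mor)
  also have "\<dots> = (ident C (unit_obj C) \<boxtimes> (?\<epsilon> \<cdot> a')) \<cdot> ((?\<epsilon> \<boxtimes> ?i) \<cdot> ?c)"
    by (simp add: slide interchange_mor_assoc del: tens_unit_mor)
  also have "\<dots> = ?\<epsilon> \<cdot> (a' \<cdot> unit X)"
    by (simp add: right)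
  finally show ?thesis .
qed

lemma rescale:
  assumes "c \<in> carrier K" "t \<in> carrier K" "t \<noteq> \<zero>\<^bsub>K\<^esub>" "mor x" "mor y" "scale c x = scale t y"
  shows "scale (c \<otimes>\<^bsub>K\<^esub> inv\<^bsub>K\<^esub> t) x = y"
proof -
  interpret R: field K by (fact field_K)
  have inv: "inv\<^bsub>K\<^esub> t \<in> carrier K" using assms(2,3) by (simp add: R.field_Units)
  have "scale (c \<otimes>\<^bsub>K\<^esub> inv\<^bsub>K\<^esub> t) x = scale (inv\<^bsub>K\<^esub> t) (scale c x)"
    using assms(1,4) inv by (simp add: scale_scale R.m_comm)
  also have "\<dots> = scale (inv\<^bsub>K\<^esub> t \<otimes>\<^bsub>K\<^esub> t) y"
    using assms(2,5,6) inv by (simp add: scale_scale)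
  also have "\<dots> = y"
    using assms(2,3,5) by (simp add: R.field_Units scale_one)
  finally show ?thesis .
qed

end

section \<open>The idempotent of two subalgebras\<close>

theorem theorem3p35:
  fixes K :: "('k, 'r) ring_scheme"
    and C :: "('o, 'm, 'k) lin_mon_cat"
    and X X1 X2 :: "('o, 'm) frob_alg"
    and f1 f2 g1 g2 :: 'm
  assumes cat: "strict_linear_monoidal_category K C"
    and simple: "linear_simple_unit K C"
    and frob: "frobenius_algebra C X" "frobenius_algebra C X1" "frobenius_algebra C X2"
    and conn: "connected_algebra K C X"
    and f1: "algebra_morphism C X1 X f1" "frob_star C X X1 (frob_star C X1 X f1) = f1"
    and f2: "algebra_morphism C X2 X f2" "frob_star C X X2 (frob_star C X2 X f2) = f2"
    and g1: "g1 = f1 \<cdot>\<^bsub>C\<^esub> frob_star C X1 X f1"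
    and g2: "g2 = f2 \<cdot>\<^bsub>C\<^esub> frob_star C X2 X f2"
  shows
    "let End = Hom C (ob X) (ob X);
         \<mu> = frob_mu K C X;
         tr = frob_tr K C X;
         g = convol C X g1 g2;
         t = tr (g1 \<cdot>\<^bsub>C\<^esub> g2)
     in
       \<mu> \<odot>\<^bsub>End\<^esub> (g \<cdot>\<^bsub>C\<^esub> g) = t \<odot>\<^bsub>End\<^esub> g \<and>
       (\<forall>\<alpha>. algebra_morphism C X X \<alpha> \<longrightarrow>
          \<mu> \<otimes>\<^bsub>K\<^esub> tr (\<alpha> \<cdot>\<^bsub>C\<^esub> g) = tr (\<alpha> \<cdot>\<^bsub>C\<^esub> g1) \<otimes>\<^bsub>K\<^esub> tr (\<alpha> \<cdot>\<^bsub>C\<^esub> g2)) \<and>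
       (t \<noteq> \<zero>\<^bsub>K\<^esub> \<longrightarrow>
         (let g12 = (\<mu> \<otimes>\<^bsub>K\<^esub> inv\<^bsub>K\<^esub> t) \<odot>\<^bsub>End\<^esub> g
          in
            g12 \<cdot>\<^bsub>C\<^esub> g12 = g12 \<and>
            (\<forall>\<alpha>. algebra_morphism C X X \<alpha> \<longrightarrow>
               tr (\<alpha> \<cdot>\<^bsub>C\<^esub> g12) =
                 (tr (\<alpha> \<cdot>\<^bsub>C\<^esub> g1) \<otimes>\<^bsub>K\<^esub> tr (\<alpha> \<cdot>\<^bsub>C\<^esub> g2)) \<otimes>\<^bsub>K\<^esub> inv\<^bsub>K\<^esub> t) \<and>
            g12 \<cdot>\<^bsub>C\<^esub> g1 = g1 \<and> g1 \<cdot>\<^bsub>C\<^esub> g12 = g1 \<and>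
            g12 \<cdot>\<^bsub>C\<^esub> g2 = g2 \<and> g2 \<cdot>\<^bsub>C\<^esub> g12 = g2))"
proof -
  interpret strict_linear_monoidal_category K C by (fact cat)
  interpret X: frobenius_object K C X by unfold_locales (fact frob)
  interpret X1: frobenius_object K C X1 by unfold_locales (fact frob)
  interpret X2: frobenius_object K C X2 by unfold_locales (fact frob)
  interpret R: field K by (fact field_K)
  define h1 where "h1 = frob_star C X1 X f1"
  define h2 where "h2 = frob_star C X2 X f2"
  define \<mu> where "\<mu> = frob_mu K C X"
  define \<phi> where "\<phi> = convol C X g1 g2"
  define \<psi> where "\<psi> = convol C X g2 g1"
  define t where "t = frob_tr K C X (g1 \<cdot>\<^bsub>C\<^esub> g2)"

  have mate1: "mate X1 X f1 h1" and mate1': "mate X X1 h1 f1"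
  proof -
    show "mate X1 X f1 h1"
      unfolding h1_def using f1(1) frob by (intro mate_frob_star) (auto simp: algebra_morphism_def)
    then have "h1 \<in> hom_set C (ob X) (ob X1)" by (simp add: mate_def)
    then show "mate X X1 h1 f1"
      using mate_frob_star[of X X1 h1] frob f1(2) by (simp add: h1_def)
  qed
  have mate2: "mate X2 X f2 h2" and mate2': "mate X X2 h2 f2"
  proof -
    show "mate X2 X f2 h2"
      unfolding h2_def using f2(1) frob by (intro mate_frob_star) (auto simp: algebra_morphism_def)
    then have "h2 \<in> hom_set C (ob X) (ob X2)" by (simp add: mate_def)
    then show "mate X X2 h2 f2"
      using mate_frob_star[of X X2 h2] frob f2(2) by (simp add: h2_def)
  qed
  note [simp] = mateD(1-6)[OF mate1 X1.ob_closed X.ob_closed]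
    mateD(1-6)[OF mate2 X2.ob_closed X.ob_closed]
  have g1: "g1 = f1 \<cdot>\<^bsub>C\<^esub> h1" and g2: "g2 = f2 \<cdot>\<^bsub>C\<^esub> h2"
    using g1 g2 by (simp_all add: h1_def h2_def)
  have self1: "mate X X g1 g1" and self2: "mate X X g2 g2"
    unfolding g1 g2 using mate_comp mate1 mate1' mate2 mate2' frob by blast+
  note [simp] = mateD(1-3)[OF self1 X.ob_closed X.ob_closed]
    mateD(1-3)[OF self2 X.ob_closed X.ob_closed]
  have g_hom: "g1 \<in> hom_set C (ob X) (ob X)" "g2 \<in> hom_set C (ob X) (ob X)"
    by (simp_all add: hom_set_iff)
  have \<phi>\<psi>: "mate X X \<phi> \<psi>" and \<psi>\<phi>: "mate X X \<psi> \<phi>"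
    unfolding \<phi>_def \<psi>_def using mate_convol frob self1 self2 by blast+
  note [simp] = mateD(1-6)[OF \<phi>\<psi> X.ob_closed X.ob_closed]
  have \<mu> [simp]: "\<mu> \<in> carrier K"
    unfolding \<mu>_def by (rule frob_mu_closed[OF simple frob(1)])
  have t [simp]: "t \<in> carrier K"
    unfolding t_def by (rule frob_tr_closed[OF simple frob(1)]) (simp add: hom_set_iff)

  have t_\<phi>: "scalar_of K C (counit X \<cdot>\<^bsub>C\<^esub> (\<phi> \<cdot>\<^bsub>C\<^esub> unit X)) = t"
    unfolding t_def \<phi>_def using frob_tr_comp_mate[OF frob(1) g_hom(1) self2] by simp
  then have t_\<psi>: "scalar_of K C (counit X \<cdot>\<^bsub>C\<^esub> (\<psi> \<cdot>\<^bsub>C\<^esub> unit X)) = t"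
    using mate_counit_unit[OF frob(1) \<phi>\<psi>] by simp

  \<comment> \<open>the scalar obtained for \<open>g\<^sub>2 * g\<^sub>1\<close> is the same \<open>t\<close>, so all four absorption laws share it\<close>
  have \<phi>f1: "scale \<mu> (\<phi> \<cdot>\<^bsub>C\<^esub> f1) = scale t f1"
    using convol_left_absorb[OF simple frob(1) conn frob(2) f1(1) mate1' g_hom(2)]
    unfolding g1[symmetric] \<phi>_def[symmetric] \<mu>_def[symmetric] t_\<phi> .
  have \<psi>f2: "scale \<mu> (\<psi> \<cdot>\<^bsub>C\<^esub> f2) = scale t f2"
    using convol_left_absorb[OF simple frob(1) conn frob(3) f2(1) mate2' g_hom(1)]
    unfolding g2[symmetric] \<psi>_def[symmetric] \<mu>_def[symmetric] t_\<psi> .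
  have \<phi>f2: "scale \<mu> (\<phi> \<cdot>\<^bsub>C\<^esub> f2) = scale t f2"
    using convol_right_absorb[OF simple frob(1) conn frob(3) f2(1) mate2 g_hom(1)]
    unfolding g2[symmetric] \<phi>_def[symmetric] \<mu>_def[symmetric] t_\<phi> .
  have \<psi>f1: "scale \<mu> (\<psi> \<cdot>\<^bsub>C\<^esub> f1) = scale t f1"
    using convol_right_absorb[OF simple frob(1) conn frob(2) f1(1) mate1 g_hom(2)]
    unfolding g1[symmetric] \<psi>_def[symmetric] \<mu>_def[symmetric] t_\<psi> .

  have \<phi>g: "scale \<mu> (\<phi> \<cdot>\<^bsub>C\<^esub> g) = scale t g"
    if "g = f \<cdot>\<^bsub>C\<^esub> h" "scale \<mu> (\<phi> \<cdot>\<^bsub>C\<^esub> f) = scale t f" "mate X' X f h" "ob X' \<in> Obj C"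
    for g f h X'
  proof -
    note [simp] = mateD(1-6)[OF that(3,4) X.ob_closed]
    have "scale \<mu> (\<phi> \<cdot>\<^bsub>C\<^esub> g) = scale \<mu> (\<phi> \<cdot>\<^bsub>C\<^esub> f) \<cdot>\<^bsub>C\<^esub> h"
      by (simp add: that(1) scale_comp)
    also have "\<dots> = scale t g"
      unfolding that(2) by (simp add: that(1) scale_comp)
    finally show ?thesis .
  qed
  note \<phi>g1 = \<phi>g[OF g1 \<phi>f1 mate1 X1.ob_closed]
    and \<phi>g2 = \<phi>g[OF g2 \<phi>f2 mate2 X2.ob_closed]

  \<comment> \<open>dualize \<open>\<mu> \<psi> f = t f\<close>: the mate of \<open>\<psi> f\<close> is \<open>h \<phi>\<close>, and mates are unique\<close>
  have g\<phi>: "scale \<mu> (g \<cdot>\<^bsub>C\<^esub> \<phi>) = scale t g"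
    if "g = f \<cdot>\<^bsub>C\<^esub> h" "scale \<mu> (\<psi> \<cdot>\<^bsub>C\<^esub> f) = scale t f" "mate X' X f h" "frobenius_algebra C X'"
    for g f h X'
  proof -
    interpret X': frobenius_object K C X' by unfold_locales (fact that)
    note [simp] = mateD(1-6)[OF that(3) X'.ob_closed X.ob_closed]
    have "mate X' X (scale \<mu> (\<psi> \<cdot>\<^bsub>C\<^esub> f)) (scale \<mu> (h \<cdot>\<^bsub>C\<^esub> \<phi>))"
      by (intro mate_scale mate_comp[OF that(4) frob(1) frob(1) that(3) \<psi>\<phi>] that(4) frob(1)) simp_all
    moreover have "mate X' X (scale t f) (scale t h)"
      by (intro mate_scale that(3,4) frob(1)) simp_all
    ultimately have "scale \<mu> (h \<cdot>\<^bsub>C\<^esub> \<phi>) = scale t h"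
      using mate_unique[OF frob(1) that(4)] that(2) by simp
    then have "f \<cdot>\<^bsub>C\<^esub> scale \<mu> (h \<cdot>\<^bsub>C\<^esub> \<phi>) = f \<cdot>\<^bsub>C\<^esub> scale t h" by simp
    then show ?thesis by (simp add: that(1) scale_comp)
  qed
  note g1\<phi> = g\<phi>[OF g1 \<psi>f1 mate1 frob(2)] and g2\<phi> = g\<phi>[OF g2 \<psi>f2 mate2 frob(3)]

  have square: "scale \<mu> (\<phi> \<cdot>\<^bsub>C\<^esub> \<phi>) = scale t \<phi>"
  proof -
  \<comment> \<open>split \<open>f\<^sub>1\<close> off the inner \<open>\<phi>\<close> and pull it out of the outer one\<close>
    have "\<phi> \<cdot>\<^bsub>C\<^esub> \<phi> = (\<phi> \<cdot>\<^bsub>C\<^esub> (mul X \<cdot>\<^bsub>C\<^esub> (f1 \<boxtimes>\<^bsub>C\<^esub> ident C (ob X))))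
        \<cdot>\<^bsub>C\<^esub> ((h1 \<boxtimes>\<^bsub>C\<^esub> g2) \<cdot>\<^bsub>C\<^esub> comul X)"
      by (subst (2) \<phi>_def) (simp add: convol_def g1 interchange_mor_assoc)
    also have "\<phi> \<cdot>\<^bsub>C\<^esub> (mul X \<cdot>\<^bsub>C\<^esub> (f1 \<boxtimes>\<^bsub>C\<^esub> ident C (ob X))) = mul X \<cdot>\<^bsub>C\<^esub> (f1 \<boxtimes>\<^bsub>C\<^esub> \<phi>)"
      using convol_left_module[OF frob(2,1) f1(1) mate1' g_hom(2)]
      by (simp add: g1[symmetric] \<phi>_def[symmetric])
    also have "\<dots> \<cdot>\<^bsub>C\<^esub> ((h1 \<boxtimes>\<^bsub>C\<^esub> g2) \<cdot>\<^bsub>C\<^esub> comul X) = convol C X g1 (\<phi> \<cdot>\<^bsub>C\<^esub> g2)"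
      by (simp add: convol_def g1 interchange_mor_assoc)
    finally have "scale \<mu> (\<phi> \<cdot>\<^bsub>C\<^esub> \<phi>) = convol C X g1 (scale \<mu> (\<phi> \<cdot>\<^bsub>C\<^esub> g2))"
      by (simp add: convol_def scale_tens scale_comp)
    also have "\<dots> = scale t \<phi>"
      unfolding \<phi>g2 by (simp add: \<phi>_def convol_def scale_tens scale_comp)
    finally show ?thesis .
  qed

  have trace: "\<mu> \<otimes>\<^bsub>K\<^esub> frob_tr K C X (\<alpha> \<cdot>\<^bsub>C\<^esub> \<phi>)
      = frob_tr K C X (\<alpha> \<cdot>\<^bsub>C\<^esub> g1) \<otimes>\<^bsub>K\<^esub> frob_tr K C X (\<alpha> \<cdot>\<^bsub>C\<^esub> g2)"
    if "algebra_morphism C X X \<alpha>" for \<alpha>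
  proof -
    have [simp]: "mor \<alpha>" "source \<alpha> = ob X" "target \<alpha> = ob X"
      and mult: "mul X \<cdot>\<^bsub>C\<^esub> (\<alpha> \<boxtimes>\<^bsub>C\<^esub> \<alpha>) = \<alpha> \<cdot>\<^bsub>C\<^esub> mul X"
      using that by (simp_all add: algebra_morphism_def hom_set_iff)
    have "\<alpha> \<cdot>\<^bsub>C\<^esub> \<phi> = (\<alpha> \<cdot>\<^bsub>C\<^esub> mul X) \<cdot>\<^bsub>C\<^esub> ((g1 \<boxtimes>\<^bsub>C\<^esub> g2) \<cdot>\<^bsub>C\<^esub> comul X)"
      by (simp add: \<phi>_def convol_def)
    also have "\<dots> = convol C X (\<alpha> \<cdot>\<^bsub>C\<^esub> g1) (\<alpha> \<cdot>\<^bsub>C\<^esub> g2)"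
      unfolding mult[symmetric] by (simp add: convol_def interchange_mor_assoc)
    finally show ?thesis
      unfolding \<mu>_def using frob_tr_convol[OF simple frob(1) conn] by (simp add: hom_set_iff)
  qed

  define k where "k = \<mu> \<otimes>\<^bsub>K\<^esub> inv\<^bsub>K\<^esub> t"
  have normalized: "k \<in> carrier K \<and> scale k \<phi> \<cdot>\<^bsub>C\<^esub> scale k \<phi> = scale k \<phi> \<and>
      (\<forall>\<alpha>. algebra_morphism C X X \<alpha> \<longrightarrow> frob_tr K C X (\<alpha> \<cdot>\<^bsub>C\<^esub> scale k \<phi>)
        = (frob_tr K C X (\<alpha> \<cdot>\<^bsub>C\<^esub> g1) \<otimes>\<^bsub>K\<^esub> frob_tr K C X (\<alpha> \<cdot>\<^bsub>C\<^esub> g2)) \<otimes>\<^bsub>K\<^esub> inv\<^bsub>K\<^esub> t) \<and>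
      scale k \<phi> \<cdot>\<^bsub>C\<^esub> g1 = g1 \<and> g1 \<cdot>\<^bsub>C\<^esub> scale k \<phi> = g1 \<and>
      scale k \<phi> \<cdot>\<^bsub>C\<^esub> g2 = g2 \<and> g2 \<cdot>\<^bsub>C\<^esub> scale k \<phi> = g2"
    if nz: "t \<noteq> \<zero>\<^bsub>K\<^esub>"
  proof -
    have inv: "inv\<^bsub>K\<^esub> t \<in> carrier K" using nz by (simp add: R.field_Units)
    then have k [simp]: "k \<in> carrier K" by (simp add: k_def)
    have cancel: "scale k x = y" if "scale \<mu> x = scale t y" "mor x" "mor y" for x y
      unfolding k_def using rescale[OF \<mu> t nz] that by blast
    have "frob_tr K C X (\<alpha> \<cdot>\<^bsub>C\<^esub> scale k \<phi>)
        = (frob_tr K C X (\<alpha> \<cdot>\<^bsub>C\<^esub> g1) \<otimes>\<^bsub>K\<^esub> frob_tr K C X (\<alpha> \<cdot>\<^bsub>C\<^esub> g2)) \<otimes>\<^bsub>K\<^esub> inv\<^bsub>K\<^esub> t"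
      if "algebra_morphism C X X \<alpha>" for \<alpha>
    proof -
      have [simp]: "mor \<alpha>" "source \<alpha> = ob X" "target \<alpha> = ob X"
        using that by (simp_all add: algebra_morphism_def hom_set_iff)
      have tr: "frob_tr K C X (\<alpha> \<cdot>\<^bsub>C\<^esub> \<phi>) \<in> carrier K"
        by (rule frob_tr_closed[OF simple frob(1)]) (simp add: hom_set_iff)
      have "frob_tr K C X (\<alpha> \<cdot>\<^bsub>C\<^esub> scale k \<phi>) = k \<otimes>\<^bsub>K\<^esub> frob_tr K C X (\<alpha> \<cdot>\<^bsub>C\<^esub> \<phi>)"
        by (simp add: scale_comp frob_tr_scale[OF simple frob(1)] hom_set_iff)
      then show ?thesis
        using tr inv by (simp add: trace[OF that, symmetric] k_def R.m_ac)
    qed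
    moreover have "scale k \<phi> \<cdot>\<^bsub>C\<^esub> \<phi> = \<phi>"
      by (simp add: scale_comp cancel square)
    ultimately show ?thesis
      by (simp add: scale_comp cancel \<phi>g1 \<phi>g2 g1\<phi> g2\<phi> square)
  qed

  have End: "c \<odot>\<^bsub>Hom C (ob X) (ob X)\<^esub> x = scale c x"
    if "mor x" "source x = ob X" "target x = ob X" for c x
    using that by (simp add: scale_def)
  show ?thesis
    using square trace normalized
    by (simp add: Let_def \<phi>_def[symmetric] \<mu>_def[symmetric] t_def[symmetric] k_def[symmetric] End)
qed

end
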